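(* For every zero-dimensional, separable, completely metrizable space $G$, there exists a Suslinian chainable metric continuum $X$ such that the set of end points of $X$, with the subspace topology, is homeomorphic to $G$.
   Context: All spaces are metrizable and separable. A space is zero-dimensional if it is non-empty and has a base consisting of sets that are both open and closed (in particular the empty space, which has dimension $-1$, is not zero-dimensional). A continuum is a non-empty, connected, compact (metric) space; one-point spaces are allowed (degenerate continua). A continuum is non-degenerate if it has more than one point. A subcontinuum of $X$ is a subset of $X$ that is a continuum. A continuum $X$ is chainable if for every $\varepsilon>0$ it has a finite covering by open sets $U_1,\ldots,U_n$ such that $\operatorname{diam} U_i<\varepsilon$ for all $i$, and $U_i\cap U_j\neq\emptyset$ if and only if $|i-j|\le 1$, for $i,j=1,\ldots,n$. A point $p$ of a chainable continuum $X$ is an end point of $X$ if for every $\varepsilon>0$ such a covering can be chosen with, moreover, $p\in U_1$. A continuum is Suslinian if every family of its pairwise disjoint non-degenerate subcontinua is countable (finite or infinite). *)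

theory Defs
  imports "HOL-Analysis.Analysis"
begin

definition zero_dimensional_space :: "'a topology \<Rightarrow> bool" where
  "zero_dimensional_space G \<longleftrightarrow> topspace G \<noteq> {} \<and>
     (\<exists>\<B>. (\<forall>U\<in>\<B>. openin G U \<and> closedin G U) \<and>
          openin G = arbitrary union_of (\<lambda>U. U \<in> \<B>))"

definition subcontinuum_of :: "'a topology \<Rightarrow> 'a set \<Rightarrow> bool" where
  "subcontinuum_of T K \<longleftrightarrow> K \<noteq> {} \<and> compactin T K \<and> connectedin T K"

definition nondegenerate :: "'a set \<Rightarrow> bool" where
  "nondegenerate K \<longleftrightarrow> (\<exists>x\<in>K. \<exists>y\<in>K. x \<noteq> y)"

definition metric_continuum :: "'a metric \<Rightarrow> bool" where
  "metric_continuum X \<longleftrightarrow> mspace X \<noteq> {} \<and>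
     compact_space (mtopology_of X) \<and> connected_space (mtopology_of X)"

definition suslinian :: "'a metric \<Rightarrow> bool" where
  "suslinian X \<longleftrightarrow> metric_continuum X \<and>
     (\<forall>\<C>. (\<forall>K\<in>\<C>. subcontinuum_of (mtopology_of X) K \<and> nondegenerate K) \<and> pairwise disjnt \<C>
          \<longrightarrow> countable \<C>)"

(* The counterpart of the type-class based diameter. As there, the supremum is only
   meaningful for bounded sets; below it is only applied to subsets of compact spaces. *)
definition mdiameter :: "'a metric \<Rightarrow> 'a set \<Rightarrow> real" where
  "mdiameter X S = (if S = {} then 0 else SUP (x,y)\<in>S \<times> S. mdist X x y)"

(* The links are U 1, ..., U n; taking i = j in the intersection condition makes them non-empty. *)
definition chain_cover :: "'a metric \<Rightarrow> real \<Rightarrow> nat \<Rightarrow> (nat \<Rightarrow> 'a set) \<Rightarrow> bool" where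
  "chain_cover X \<epsilon> n U \<longleftrightarrow>
     (\<Union>i\<in>{1..n}. U i) = mspace X \<and>
     (\<forall>i\<in>{1..n}. openin (mtopology_of X) (U i) \<and> mdiameter X (U i) < \<epsilon>) \<and>
     (\<forall>i\<in>{1..n}. \<forall>j\<in>{1..n}. U i \<inter> U j \<noteq> {} \<longleftrightarrow> \<bar>int i - int j\<bar> \<le> 1)"

definition chainable :: "'a metric \<Rightarrow> bool" where
  "chainable X \<longleftrightarrow> metric_continuum X \<and> (\<forall>\<epsilon>>0. \<exists>n U. chain_cover X \<epsilon> n U)"

(* Intended for chainable X. As mspace X is then non-empty, a chain cover has n \<ge> 1,
   so U 1 is one of its links. *)
definition end_points :: "'a metric \<Rightarrow> 'a set" where
  "end_points X = {p \<in> mspace X. \<forall>\<epsilon>>0. \<exists>n U. chain_cover X \<epsilon> n U \<and> p \<in> U 1}"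

(* Carrier type for metric continua. A compact metric space has at most continuum many
   points, so each one is isometric to some (nat \<Rightarrow> real) metric. The carrier set and the
   distance are arbitrary and unrelated to the topology or metric of the type nat \<Rightarrow> real. *)
type_synonym point = "nat \<Rightarrow> real"

end

theory Submission
  imports Defs
begin

text \<open>
  In a chainable continuum all of whose subcontinua are decomposable, a subcontinuum is layered over
  an arc, and its end points lie in its two extreme layers. This suggests building the continuum as
  an inverse limit of arcs along a tree: a set of future end points is split into two parts, and the
  continuum becomes a copy \<open>K\<close> for the first part, an edge, and a copy \<open>K'\<close> for the second part,
  where the edge oscillates closer and closer along all of \<open>K\<close> at one end and along all of \<open>K'\<close> at the other.

  A splitting into two parts at a time makes the set of end points compact. For a splitting of a set
  into infinitely many parts \<open>G\<^sub>0, G\<^sub>1, \<dots>\<close>, the copies for \<open>G\<^sub>2, G\<^sub>3, \<dots>\<close> are inserted one after the other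
  between the copy \<open>L\<close> for \<open>G\<^sub>0 \<union> G\<^sub>1\<close> and the copies inserted earlier, and the new copy starts out at a
  point in the middle of the edge of \<open>L\<close>. Thus these copies accumulate only at a point that is not an end point.

  A point is an end point if at infinitely many stages it sits at a leaf of the tree: there the
  bonding map factors through an arc that starts at the point, by folding the next arc.
  Every other point eventually stays on one edge, and the two sides of that edge are two
  subcontinua neither of which contains the other. Similarly, a non-degenerate subcontinuum contains
  a piece of an edge, hence one of countably many points, which gives the Suslinian property.
\<close>

subsection \<open>Chain covers and subcontinua of compact metric spaces\<close>

text \<open>The difficulty is that a leaf in the middle of an arc has to become an end point,
  although the continuum goes on from it in both directions. Both sides must be folded together into
  one arc starting at the leaf, and this folded arc must be continued whenever an edge leaves the
  subtree folded so far. If the last run of the folded arc leads away from the edge, it has to be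
  followed to its end and turned there. An edge that sweeps over the whole subtree offers exactly
  this turn, and this fixes the edge lengths in \<open>step\<close>.

  Apart from the leaves, over which a whole arc is collapsed, the bonding maps have slope 1 or -1.
  Within the evolution of a node, an interior point of its edge has a single preimage, so one
  coordinate determines all later ones; rational coordinates then give the countable set for the
  Suslinian property.

  Completeness of \<open>G\<close> serves the converse inclusion for end points: a point of the
  limit that returns to leaves again and again runs through a branch of non-empty parts, and such a
  branch has to contain a point of \<open>G\<close>.\<close>

abbreviation metric_on :: "'a::metric_space set \<Rightarrow> 'a metric" where
  "metric_on S \<equiv> submetric euclidean_metric S"

lemma mtopology_of_metric_on: "mtopology_of (metric_on S) = top_of_set S"
  by (simp add: mtopology_of_submetric)

lemma subcontinuum_of_metric_on:
  "subcontinuum_of (mtopology_of (metric_on S)) K \<longleftrightarrow> K \<noteq> {} \<and> compact K \<and> connected K \<and> K \<subseteq> S"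
  by (auto simp: subcontinuum_of_def mtopology_of_metric_on compactin_subtopology connectedin_subtopology)

lemma metric_continuum_metric_on:
  "metric_continuum (metric_on S) \<longleftrightarrow> S \<noteq> {} \<and> compact S \<and> connected S"
proof -
  have "connected_space (top_of_set S) \<longleftrightarrow> connected S" using connectedin_def[of euclidean S] by simp
  then show ?thesis by (auto simp: metric_continuum_def mtopology_of_metric_on compact_space_def compactin_subtopology)
qed

lemma mdiameter_metric_on_le:
  assumes "\<And>x y. x \<in> S \<Longrightarrow> y \<in> S \<Longrightarrow> dist x y \<le> e" "0 \<le> e"
  shows "mdiameter (metric_on X) S \<le> e"
  using assms unfolding mdiameter_def by (auto intro!: cSUP_least)

lemma dist_le_mdiameter:
  assumes "bounded X" "S \<subseteq> X" "x \<in> S" "y \<in> S"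
  shows "dist x y \<le> mdiameter (metric_on X) S"
proof -
  have "bdd_above ((\<lambda>(x, y). dist x y) ` (S \<times> S))"
  proof -
    have "bounded S" using assms bounded_subset by blast
    then obtain e where "\<forall>x\<in>S. \<forall>y\<in>S. dist x y \<le> e" using bounded_two_points by blast
    then show ?thesis by (intro bdd_aboveI[of _ e]) auto
  qed
  then have "(\<lambda>(x, y). dist x y) (x, y) \<le> (SUP (x, y)\<in>S \<times> S. dist x y)"
    using assms by (intro cSUP_upper) auto
  then show ?thesis using assms by (auto simp: mdiameter_def)
qed

text \<open>Pull back a chain of short intervals along \<open>g\<close>. The gap between
  \<open>e\<close> and \<open>\<epsilon>\<close> is there because a supremum of distances below
  \<open>e\<close> is only known to be at most \<open>e\<close>.\<close>

lemma chain_cover_from_map: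
  fixes X :: "'a::metric_space set" and g :: "'a \<Rightarrow> real"
  assumes X: "compact X" "connected X" "p \<in> X" and g: "continuous_on X g"
    and g0: "g p = 0" "\<And>x. x \<in> X \<Longrightarrow> 0 \<le> g x"
    and fib: "\<And>x y. x \<in> X \<Longrightarrow> y \<in> X \<Longrightarrow> g x = g y \<Longrightarrow> dist x y < e" and e: "0 < e" "e < \<epsilon>"
  shows "\<exists>n U. chain_cover (metric_on X) \<epsilon> n U \<and> p \<in> U 1"
proof -
  \<comment> \<open>Pairs at distance at least \<open>e\<close> form a compact set on which the
    difference of the values of \<open>g\<close> has a positive minimum, unless there are no such
    pairs.\<close>
  obtain \<eta> where \<eta>: "\<eta> > 0" "\<And>x y. x \<in> X \<Longrightarrow> y \<in> X \<Longrightarrow> \<bar>g x - g y\<bar> < \<eta> \<Longrightarrow> dist x y < e"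
  proof (cases "{z \<in> X \<times> X. e \<le> dist (fst z) (snd z)} = {}")
    case True
    show ?thesis by (rule that[of 1]) (use True in \<open>auto simp: not_le\<close>)
  next
    case False
    let ?K = "{z \<in> X \<times> X. e \<le> dist (fst z) (snd z)}"
    have "compact (X \<times> X)" using X compact_Times by blast
    moreover have "closed {z::'a \<times> 'a. e \<le> dist (fst z) (snd z)}"
      by (intro closed_Collect_le continuous_intros)
    ultimately have "compact (X \<times> X \<inter> {z. e \<le> dist (fst z) (snd z)})" by (rule compact_Int_closed)
    then have K: "compact ?K" by (simp add: Collect_conj_eq)
    have "continuous_on ?K (\<lambda>z. \<bar>g (fst z) - g (snd z)\<bar>)"
      by (intro continuous_intros continuous_on_compose2[OF g]) auto
    from continuous_attains_inf[OF K False this] obtain w where w: "w \<in> ?K"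
      "\<And>z. z \<in> ?K \<Longrightarrow> \<bar>g (fst w) - g (snd w)\<bar> \<le> \<bar>g (fst z) - g (snd z)\<bar>" by blast
    have "g (fst w) \<noteq> g (snd w)" using fib[of "fst w" "snd w"] w(1) by force
    show ?thesis
    proof (rule that[of "\<bar>g (fst w) - g (snd w)\<bar>"])
      show "dist x y < e" if "x \<in> X" "y \<in> X" "\<bar>g x - g y\<bar> < \<bar>g (fst w) - g (snd w)\<bar>" for x y
        using w(2)[of "(x, y)"] that by force
    qed (use \<open>g (fst w) \<noteq> g (snd w)\<close> in auto)
  qed
  define \<delta> where "\<delta> = \<eta> / 2"
  have \<delta>: "0 < \<delta>" using \<eta> by (simp add: \<delta>_def)
  obtain m where m: "m \<in> X" "\<And>x. x \<in> X \<Longrightarrow> g x \<le> g m"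
    using continuous_attains_sup[OF X(1) _ g] X(3) by blast
  \<comment> \<open>The value \<open>(n - 1) * \<delta>\<close> is still attained, so the last link
    is non-empty, while \<open>n * \<delta>\<close> exceeds the maximum of \<open>g\<close>.\<close>
  define n where "n = Suc (nat \<lfloor>g m / \<delta>\<rfloor>)"
  have gm: "0 \<le> g m / \<delta>" using g0 m \<delta> by simp
  have n1: "real (n - 1) * \<delta> \<le> g m" 
  proof -
    have "real (n - 1) \<le> g m / \<delta>" unfolding n_def using gm by simp
    then show ?thesis using \<delta> by (simp add: field_simps)
  qed
  have n2: "g m < real n * \<delta>"
  proof -
    have "g m / \<delta> < real n" unfolding n_def using gm by linarith
    then show ?thesis using \<delta> by (simp add: field_simps)
  qed
  have onto: "\<exists>x\<in>X. g x = v" if "0 \<le> v" "v \<le> g m" for v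
  proof -
    have "connected (g ` X)" using X g connected_continuous_image by blast
    moreover have "0 \<in> g ` X" "g m \<in> g ` X" using g0 X(3) m by force+
    ultimately have "v \<in> g ` X" using that connectedD_interval by metis
    then show ?thesis by auto
  qed
  \<comment> \<open>Consecutive intervals overlap in length 2/3 \<delta>, intervals two apart leave
    a gap of 1/3 \<delta>, and the common length 5/3 \<delta> is below \<open>\<eta>\<close> = 2
    \<delta>.\<close>
  define U where "U = (\<lambda>i::nat. {x \<in> X. (real i - 4/3) * \<delta> < g x \<and> g x < (real i + 1/3) * \<delta>})"
  have "chain_cover (metric_on X) \<epsilon> n U"
    unfolding chain_cover_def
  proof (intro conjI ballI)
    show "(\<Union>i\<in>{1..n}. U i) = mspace (metric_on X)"
    proof (auto simp: U_def)
      fix x assume x: "x \<in> X"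
      define i where "i = Suc (nat \<lfloor>g x / \<delta>\<rfloor>)"
      have gx: "0 \<le> g x / \<delta>" "g x / \<delta> \<le> g m / \<delta>" using g0 m \<delta> x by (simp_all add: divide_right_mono)
      have "real i - 1 \<le> g x / \<delta>" "g x / \<delta> < real i" unfolding i_def using gx by linarith+
      then have "real i * \<delta> - \<delta> \<le> g x" "g x < real i * \<delta>" using \<delta> by (simp_all add: field_simps)
      then have "real i * \<delta> - 4/3 * \<delta> < g x \<and> g x < real i * \<delta> + 1/3 * \<delta>" using \<delta> by auto
      then have "(real i - 4/3) * \<delta> < g x \<and> g x < (real i + 1/3) * \<delta>"
        by (simp only: left_diff_distrib distrib_right)
      moreover have "i \<in> {Suc 0..n}"
      proof -
        have "nat \<lfloor>g x / \<delta>\<rfloor> \<le> nat \<lfloor>g m / \<delta>\<rfloor>" using gx(2) by (intro nat_mono floor_mono)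
        then show ?thesis unfolding i_def n_def by simp
      qed
      ultimately show "\<exists>i\<in>{Suc 0..n}. (real i - 4/3) * \<delta> < g x \<and> g x < (real i + 1/3) * \<delta>" by blast
    qed
  next
    fix i assume "i \<in> {1..n}"
    have "openin (top_of_set X) (X \<inter> g -` {(real i - 4/3) * \<delta> <..< (real i + 1/3) * \<delta>})"
      by (rule continuous_openin_preimage_gen[OF g open_greaterThanLessThan])
    moreover have "X \<inter> g -` {(real i - 4/3) * \<delta> <..< (real i + 1/3) * \<delta>} = U i" unfolding U_def by auto
    ultimately show "openin (mtopology_of (metric_on X)) (U i)" by (simp add: mtopology_of_metric_on)
    have "mdiameter (metric_on X) (U i) \<le> e"
    proof (rule mdiameter_metric_on_le)
      fix x y assume xy: "x \<in> U i" "y \<in> U i"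
      have w: "(real i + 1/3) * \<delta> - (real i - 4/3) * \<delta> = 5/3 * \<delta>" by (simp add: field_simps)
      have "x \<in> X" "y \<in> X" "(real i - 4/3) * \<delta> < g x" "g x < (real i + 1/3) * \<delta>"
        "(real i - 4/3) * \<delta> < g y" "g y < (real i + 1/3) * \<delta>"
        using xy unfolding U_def by blast+
      then have "x \<in> X" "y \<in> X" "\<bar>g x - g y\<bar> < 2 * \<delta>" using w \<delta> by linarith+
      then show "dist x y \<le> e" using \<eta>(2)[of x y] by (simp add: \<delta>_def)
    qed (use e in simp)
    then show "mdiameter (metric_on X) (U i) < \<epsilon>" using e by simp
  next
    fix i j assume ij: "i \<in> {1..n}" "j \<in> {1..n}"
    have disj: "U i \<inter> U j = {}" if "i + 2 \<le> j" for i j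
    proof -
      have "(real i + 1/3) * \<delta> \<le> (real j - 4/3) * \<delta>" using that \<delta> by (intro mult_right_mono) auto
      then have False if "x \<in> U i" "x \<in> U j" for x
      proof -
        have "g x < (real i + 1/3) * \<delta>" "(real j - 4/3) * \<delta> < g x" using that unfolding U_def by blast+
        then show False using \<open>(real i + 1/3) * \<delta> \<le> (real j - 4/3) * \<delta>\<close> by linarith
      qed
      then show ?thesis by blast
    qed
    have touch: "U i \<inter> U j \<noteq> {}" if "1 \<le> i" "i \<le> j" "j \<le> n" "j \<le> Suc i" for i j
    proof -
      have "real (j - 1) * \<delta> \<le> real (n - 1) * \<delta>" using that \<delta> by (intro mult_right_mono) auto
      then have "real (j - 1) * \<delta> \<le> g m" using n1 by linarith
      moreover have "0 \<le> real (j - 1) * \<delta>" using \<delta> by simp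
      ultimately obtain x where x: "x \<in> X" "g x = real (j - 1) * \<delta>" using onto by blast
      have "x \<in> U k" if "j = k \<or> j = Suc k" "1 \<le> k" for k
      proof -
        have "real (j - 1) = real k - 1 \<or> real (j - 1) = real k" using that by auto
        then have "(real k - 4/3) * \<delta> < real (j - 1) * \<delta> \<and> real (j - 1) * \<delta> < (real k + 1/3) * \<delta>"
          using \<delta> by auto
        then show ?thesis unfolding U_def using x by auto
      qed
      moreover have "j = i \<or> j = Suc i" using that by linarith
      ultimately have "x \<in> U i" "x \<in> U j" using that by auto
      then show ?thesis by blast
    qed
    show "U i \<inter> U j \<noteq> {} \<longleftrightarrow> \<bar>int i - int j\<bar> \<le> 1"
    proof
      assume "U i \<inter> U j \<noteq> {}"
      then have "\<not> i + 2 \<le> j" "\<not> j + 2 \<le> i" using disj[of i j] disj[of j i] by blast+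
      then show "\<bar>int i - int j\<bar> \<le> 1" by linarith
    next
      assume "\<bar>int i - int j\<bar> \<le> 1"
      then have "(i \<le> j \<and> j \<le> Suc i) \<or> (j \<le> i \<and> i \<le> Suc j)" by linarith
      then show "U i \<inter> U j \<noteq> {}" using touch[of i j] touch[of j i] ij by auto
    qed
  qed
  moreover have "p \<in> U 1" using X(3) g0 \<delta> by (simp add: U_def)
  ultimately show ?thesis by blast
qed

text \<open>
  For \<open>a \<in> A - B\<close> and \<open>b \<in> B - A\<close>, consider a fine chain starting at \<open>p\<close> in which a link of \<open>a\<close> comes no later
  than one of \<open>b\<close>. The connected set \<open>B\<close> meets all links between \<open>p\<close> and \<open>b\<close>, so it comes close to \<open>a\<close>.
\<close>

lemma end_point_nested:
  fixes X :: "'a::metric_space set"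
  assumes X: "compact X" and p: "p \<in> end_points (metric_on X)"
    and A: "connected A" "closed A" "A \<subseteq> X" "p \<in> A" and B: "connected B" "closed B" "B \<subseteq> X" "p \<in> B"
  shows "A \<subseteq> B \<or> B \<subseteq> A"
proof (rule ccontr)
  assume "\<not> (A \<subseteq> B \<or> B \<subseteq> A)"
  then obtain a b where ab: "a \<in> A" "a \<notin> B" "b \<in> B" "b \<notin> A" by blast
  obtain e where e: "e > 0" "ball a e \<inter> B = {}" "ball b e \<inter> A = {}"
  proof -
    obtain e1 where "e1 > 0" "ball a e1 \<subseteq> - B" using ab B by (meson ComplI open_Compl open_contains_ball)
    moreover obtain e2 where "e2 > 0" "ball b e2 \<subseteq> - A" using ab A by (meson ComplI open_Compl open_contains_ball)
    ultimately show ?thesis by (intro that[of "min e1 e2"]) (auto simp: subset_iff)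
  qed
  obtain n U where U: "chain_cover (metric_on X) e n U" "p \<in> U 1"
    using p e(1) by (auto simp: end_points_def)
  have cov: "(\<Union>i\<in>{1..n}. U i) = X" using U(1) by (simp add: chain_cover_def)
  have op: "openin (top_of_set X) (U i)" "mdiameter (metric_on X) (U i) < e" if "i \<in> {1..n}" for i
    using U(1) that by (auto simp: chain_cover_def mtopology_of_metric_on)
  have meet: "U i \<inter> U j \<noteq> {} \<longleftrightarrow> \<bar>int i - int j\<bar> \<le> 1" if "i \<in> {1..n}" "j \<in> {1..n}" for i j
    using U(1) that by (auto simp: chain_cover_def)
  have close: "dist x y < e" if "i \<in> {1..n}" "x \<in> U i" "y \<in> U i" for i x y
  proof -
    have "U i \<subseteq> X" using cov that by auto
    then show ?thesis
      using dist_le_mdiameter[of X "U i" x y] compact_imp_bounded[OF X] that op(2)[of i] by auto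
  qed
  have walk: "C \<inter> U i \<noteq> {}" if C: "connected C" "C \<subseteq> X" "p \<in> C" "c \<in> C" "c \<in> U j" and ij: "1 \<le> i" "i \<le> j" "j \<le> n" for C c i j
  proof
    assume emp: "C \<inter> U i = {}"
    then have ij': "1 < i" "i < j" using ij C U(2) by (auto simp: le_less)
    let ?L = "\<Union>k\<in>{1..<i}. U k" and ?R = "\<Union>k\<in>{i<..n}. U k"
    have "openin (top_of_set X) ?L" "openin (top_of_set X) ?R"
      using op(1) ij by (auto intro!: openin_Union)
    then obtain L R where LR: "open L" "open R" "?L = X \<inter> L" "?R = X \<inter> R"
      unfolding openin_open by metis
    have "U k \<inter> U k' = {}" if "k \<in> {1..<i}" "k' \<in> {i<..n}" for k k'
      using meet[of k k'] that ij by auto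
    then have "?L \<inter> ?R = {}" by blast
    then have "L \<inter> R \<inter> C = {}" using LR C by blast
    moreover have "C \<subseteq> L \<union> R"
    proof
      fix x assume "x \<in> C"
      then obtain k where k: "k \<in> {1..n}" "x \<in> U k" using cov C by blast
      then have "k \<noteq> i" using emp \<open>x \<in> C\<close> by blast
      then have "x \<in> ?L \<or> x \<in> ?R" using k by (cases "k < i") auto
      then show "x \<in> L \<union> R" using LR by blast
    qed
    moreover have "p \<in> L \<inter> C" using LR C U(2) ij' by auto
    moreover have "c \<in> R \<inter> C" using LR C ij' ij by auto
    ultimately show False using connectedD[OF C(1) LR(1,2)] by blast
  qed
  obtain i where i: "i \<in> {1..n}" "a \<in> U i" using cov ab A by blast
  obtain j where j: "j \<in> {1..n}" "b \<in> U j" using cov ab B by blast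
  show False
  proof (cases "i \<le> j")
    case True
    then obtain y where "y \<in> B" "y \<in> U i" using walk[OF B(1,3,4) ab(3) j(2), of i] i j by auto
    then show False using close[OF i(1) i(2), of y] e(2) by auto
  next
    case False
    then obtain y where "y \<in> A" "y \<in> U j" using walk[OF A(1,3,4) ab(1) i(2), of j] i j by auto
    then show False using close[OF j(1) j(2), of y] e(3) by auto
  qed
qed

lemma suslinian_if_countable_hits:
  assumes X: "metric_continuum (metric_on X)" and D: "countable D"
    and hit: "\<And>K. compact K \<Longrightarrow> connected K \<Longrightarrow> K \<subseteq> X \<Longrightarrow> nondegenerate K \<Longrightarrow> K \<inter> D \<noteq> {}"
  shows "suslinian (metric_on X)"
  unfolding suslinian_def
proof (intro conjI X allI impI)
  fix \<C> :: "'a set set"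
  assume \<C>: "(\<forall>K\<in>\<C>. subcontinuum_of (mtopology_of (metric_on X)) K \<and> nondegenerate K) \<and> pairwise disjnt \<C>"
  then have "\<forall>K\<in>\<C>. \<exists>d. d \<in> K \<inter> D" using hit by (auto simp: subcontinuum_of_metric_on)
  then obtain f where f: "\<forall>K\<in>\<C>. f K \<in> K \<inter> D" by metis
  have "inj_on f \<C>"
    using f \<C> by (intro inj_onI) (metis Int_iff disjnt_iff pairwiseD)
  moreover have "countable (f ` \<C>)" using f D by (intro countable_subset[OF _ D]) auto
  ultimately show "countable \<C>" using countable_image_inj_on by blast
qed

section \<open>Nested intersections of compact sets\<close>

lemma compact_nest_nonempty:
  fixes K :: "nat \<Rightarrow> 'a::t2_space set"
  assumes K: "\<And>n. compact (K n)" "\<And>n. K n \<noteq> {}" "\<And>n. K (Suc n) \<subseteq> K n"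
  shows "(\<Inter>n. K n) \<noteq> {}"
proof -
  have dec: "K n \<subseteq> K m" if "m \<le> n" for m n using that K(3) by (rule lift_Suc_antimono_le[rotated])
  have "K 0 \<inter> (\<Inter>n\<in>UNIV. K n) \<noteq> {}"
  proof (rule compact_imp_fip_image[OF K(1)])
    show "closed (K n)" for n using K(1) compact_imp_closed by blast
    fix I' :: "nat set" assume "finite I'"
    then obtain m where "\<And>i. i \<in> I' \<Longrightarrow> i \<le> m" using finite_nat_set_iff_bounded_le by auto
    then have "K m \<subseteq> K 0 \<inter> (\<Inter>n\<in>I'. K n)" using dec by blast
    then show "K 0 \<inter> (\<Inter>n\<in>I'. K n) \<noteq> {}" using K(2)[of m] by blast
  qed
  then show ?thesis by blast
qed

text \<open>If the intersection fell into closed pieces \<open>A\<close> and \<open>B\<close>, the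
  difference of the distances to them would have a zero in every connected \<open>K n\<close>. The
  zero sets are nested and compact, so a common zero would lie in \<open>A\<close> or
  \<open>B\<close>, where there is none.\<close>

lemma connected_nested_Inter:
  fixes K :: "nat \<Rightarrow> 'a::metric_space set"
  assumes K: "\<And>n. compact (K n)" "\<And>n. connected (K n)" "\<And>n. K (Suc n) \<subseteq> K n"
  shows "connected (\<Inter>n. K n)"
proof (rule ccontr)
  assume "\<not> connected (\<Inter>n. K n)"
  moreover have cl: "closed (\<Inter>n. K n)" using K(1) compact_imp_closed by blast
  ultimately obtain A B where AB: "closed A" "closed B" "A \<union> B = (\<Inter>n. K n)" "A \<inter> B = {}" "A \<noteq> {}" "B \<noteq> {}"
    using connected_closed_set by metis
  define \<phi> where "\<phi> x = infdist x A - infdist x B" for x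
  have co: "continuous_on S \<phi>" for S unfolding \<phi>_def by (intro continuous_intros)
  have \<phi>A: "\<phi> x < 0" if "x \<in> A" for x
  proof -
    have "infdist x B \<noteq> 0" using AB that in_closed_iff_infdist_zero[of B x] by blast
    then show ?thesis using that infdist_nonneg[of x B] by (simp add: \<phi>_def)
  qed
  have \<phi>B: "\<phi> x > 0" if "x \<in> B" for x
  proof -
    have "infdist x A \<noteq> 0" using AB that in_closed_iff_infdist_zero[of A x] by blast
    then show ?thesis using that infdist_nonneg[of x A] by (simp add: \<phi>_def)
  qed
  obtain a b where ab: "a \<in> A" "b \<in> B" using AB by blast
  have "(\<Inter>n. K n \<inter> \<phi> -` {0}) \<noteq> {}"
  proof (rule compact_nest_nonempty)
    have "closed (\<phi> -` {0})" using co[of UNIV] by (intro continuous_closed_vimage) (auto simp: continuous_on_eq_continuous_at)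
    then show "compact (K n \<inter> \<phi> -` {0})" for n using K(1) compact_Int_closed by blast
    show "K n \<inter> \<phi> -` {0} \<noteq> {}" for n
    proof -
      have "a \<in> K n" "b \<in> K n" using ab AB by blast+
      then have "\<phi> a \<in> \<phi> ` K n" "\<phi> b \<in> \<phi> ` K n" by auto
      moreover have "connected (\<phi> ` K n)" using K(2) co connected_continuous_image by blast
      ultimately have "0 \<in> \<phi> ` K n"
        using \<phi>A[OF ab(1)] \<phi>B[OF ab(2)] connectedD_interval by (metis less_imp_le)
      then show ?thesis by auto
    qed
    show "K (Suc n) \<inter> \<phi> -` {0} \<subseteq> K n \<inter> \<phi> -` {0}" for n using K(3) by blast
  qed
  then obtain x where "x \<in> A \<union> B" "\<phi> x = 0" using AB by auto
  then show False using \<phi>A \<phi>B by force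
qed

subsection \<open>Inverse limits of intervals\<close>

definition inverse_limit :: "(nat \<Rightarrow> real \<Rightarrow> real) \<Rightarrow> (nat \<Rightarrow> real set) \<Rightarrow> (nat \<Rightarrow> real) set" where
  "inverse_limit f I = {x. \<forall>n. x n \<in> I n \<and> x n = f n (x (Suc n))}"

text \<open>\<open>\<Phi> m\<close> overwrites the coordinates \<open>m - 1\<close>, ..., 0 in this
  order by the values that the bonding maps dictate. The limit is thus a nested intersection of
  continuous images of the box, each of them compact and connected.\<close>

lemma inverse_limit_continuum:
  fixes \<alpha> \<beta> :: "nat \<Rightarrow> real"
  assumes I: "\<And>n. \<alpha> n \<le> \<beta> n" and f: "\<And>n. continuous_on {\<alpha> (Suc n)..\<beta> (Suc n)} (f n)"
    and im: "\<And>n x. x \<in> {\<alpha> (Suc n)..\<beta> (Suc n)} \<Longrightarrow> f n x \<in> {\<alpha> n..\<beta> n}"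
  defines "L \<equiv> inverse_limit f (\<lambda>n. {\<alpha> n..\<beta> n})"
  shows "compact L" "connected L" "L \<noteq> {}"
proof -
  define box where "box = (PiE UNIV (\<lambda>n. {\<alpha> n..\<beta> n}) :: (nat \<Rightarrow> real) set)"
  have mem_box: "z \<in> box \<longleftrightarrow> (\<forall>n. z n \<in> {\<alpha> n..\<beta> n})" for z by (auto simp: box_def PiE_iff)
  have "compactin (product_topology (\<lambda>i. euclidean) UNIV) box"
    unfolding box_def compactin_PiE by simp
  then have box_compact: "compact box" by (simp add: euclidean_product_topology)
  have "connectedin (product_topology (\<lambda>i. euclidean) UNIV) box"
    unfolding box_def connectedin_PiE by simp
  then have box_connected: "connected box" by (simp add: euclidean_product_topology)
  have "\<alpha> \<in> box" using I by (simp add: mem_box)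
  define u where "u m z = z(m := f m (z (Suc m)))" for m and z :: "nat \<Rightarrow> real"
  define \<Phi> where "\<Phi> = rec_nat (\<lambda>z. z) (\<lambda>m h z. h (u m z))"
  have \<Phi>: "\<Phi> 0 z = z" "\<Phi> (Suc m) z = \<Phi> m (u m z)" for m z by (simp_all add: \<Phi>_def)
  have u_box: "u m ` box \<subseteq> box" for m
  proof
    fix w assume "w \<in> u m ` box"
    then obtain z where z: "z \<in> box" "w = u m z" by blast
    show "w \<in> box"
      unfolding mem_box
    proof
      show "w n \<in> {\<alpha> n..\<beta> n}" for n
        using z im[of "z (Suc m)" m] unfolding mem_box by (cases "n = m") (simp_all add: u_def)
    qed
  qed
  have \<Phi>_box: "\<Phi> m ` box \<subseteq> box" for m
  proof (induction m)
    case (Suc m)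
    then show ?case using u_box[of m] unfolding image_subset_iff \<Phi> by blast
  qed (simp add: \<Phi>)
  have u_cont: "continuous_on box (u m)" for m
  proof (rule continuous_on_coordinatewise_then_product)
    fix i
    have co: "continuous_on box (\<lambda>z. z k)" for k
      by (rule continuous_on_subset[OF continuous_on_product_coordinates]) simp
    have "(\<lambda>z. z (Suc m)) ` box \<subseteq> {\<alpha> (Suc m)..\<beta> (Suc m)}" 
      using mem_box[THEN iffD1, rule_format] by (intro image_subsetI)
    then have "continuous_on box (\<lambda>z. f m (z (Suc m)))" by (rule continuous_on_compose2[OF f co])
    then show "continuous_on box (\<lambda>z. u m z i)" using co by (cases "i = m") (simp_all add: u_def)
  qed
  have \<Phi>_cont: "continuous_on box (\<Phi> m)" for m
  proof (induction m)
    case (Suc m)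
    then show ?case using continuous_on_compose2[OF Suc u_cont u_box[of m]] by (simp add: \<Phi>)
  qed (simp add: \<Phi>)
  have ge: "\<Phi> m z n = z n" if "m \<le> n" for m n z
    using that by (induction m arbitrary: z) (auto simp: \<Phi> u_def)
  have lt: "\<Phi> m z n = f n (\<Phi> m z (Suc n))" if "n < m" for m n z
    using that
  proof (induction m arbitrary: z)
    case (Suc m)
    show ?case
    proof (cases "n = m")
      case True
      then show ?thesis using ge[of m m "u m z"] ge[of m "Suc m" "u m z"] by (simp add: \<Phi> u_def)
    next
      case False
      then show ?thesis using Suc by (simp add: \<Phi>)
    qed
  qed simp
  have L: "L = (\<Inter>m. \<Phi> m ` box)"
  proof (intro set_eqI iffI)
    fix x assume "x \<in> L"
    then have *: "\<forall>n. x n \<in> {\<alpha> n..\<beta> n} \<and> x n = f n (x (Suc n))"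
      unfolding L_def inverse_limit_def by (rule CollectD)
    then have "x \<in> box" unfolding mem_box by blast
    have "u m x = x" for m unfolding u_def using * by (intro fun_upd_idem) blast
    note x = \<open>x \<in> box\<close> this
    have "\<Phi> m x = x" for m by (induction m) (simp_all add: \<Phi> x(2))
    then have "x \<in> \<Phi> m ` box" for m using x(1) by (intro image_eqI[of _ _ x]) simp_all
    then show "x \<in> (\<Inter>m. \<Phi> m ` box)" by blast
  next
    fix x assume "x \<in> (\<Inter>m. \<Phi> m ` box)"
    then have x: "x \<in> \<Phi> m ` box" for m by blast
    have "x \<in> box" using x[of 0] by (simp add: \<Phi>)
    moreover have "x n = f n (x (Suc n))" for n
    proof -
      obtain z where "x = \<Phi> (Suc n) z" using x[of "Suc n"] by blast
      then show ?thesis using lt[of n "Suc n" z] by (simp only: lessI)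
    qed
    ultimately show "x \<in> L" unfolding L_def inverse_limit_def mem_box by blast
  qed
  have K: "compact (\<Phi> m ` box)" "connected (\<Phi> m ` box)" "\<Phi> (Suc m) ` box \<subseteq> \<Phi> m ` box" "\<Phi> m ` box \<noteq> {}" for m
    using compact_continuous_image[OF \<Phi>_cont box_compact] connected_continuous_image[OF \<Phi>_cont box_connected]
      u_box[of m] \<open>\<alpha> \<in> box\<close> by (auto simp: \<Phi>)
  show "L \<noteq> {}" unfolding L by (rule compact_nest_nonempty) (use K in auto)
  show "connected L" unfolding L by (rule connected_nested_Inter) (use K in auto)
  have "closed L" unfolding L using K(1) compact_imp_closed by blast
  moreover have "L = \<Phi> 0 ` box \<inter> L" unfolding L by blast
  ultimately show "compact L" using K(1)[of 0] compact_Int_closed by metis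
qed

lemma dist_fun_less_if_initial_agree:
  fixes e :: real
  assumes "e > 0"
  shows "\<exists>N. \<forall>x y :: nat \<Rightarrow> real. (\<forall>n\<le>N. x n = y n) \<longrightarrow> dist x y < e"
proof -
  obtain N where N: "(1/2)^N < e" using real_arch_pow_inv[of e "1/2"] assms by auto
  \<comment> \<open>The metric on functions weights the indices in the order of
    \<open>from_nat\<close>, so the first terms of its series concern the indices
    \<open>from_nat 0\<close>, ..., \<open>from_nat N\<close>.\<close>
  have "dist x y < e" if "\<forall>n\<le>Max (from_nat ` {..N}). x n = y n" for x y :: "nat \<Rightarrow> real"
  proof -
    have eq: "x (from_nat n) = y (from_nat n)" if "n \<le> N" for n
      using \<open>\<forall>n\<le>_. x n = y n\<close> that by (auto intro!: Max_ge)
    have "{dist (x (from_nat n)) (y (from_nat n)) |n. n \<le> N} = (\<lambda>n. 0) ` {..N}"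
      using eq by (force simp: image_def)
    then have "{dist (x (from_nat n)) (y (from_nat n)) |n. n \<le> N} = {0}" by auto
    then have "dist x y \<le> (1/2)^N" using dist_fun_le_dist_first_terms[of x y N] by simp
    then show ?thesis using N by simp
  qed
  then show ?thesis by blast
qed

subsection \<open>Trees and bonding maps\<close>

text \<open>
  A tree describes an arc, read from left to right with coordinates in \<open>[0, len t]\<close>. The address \<open>s\<close> of a
  part lists its indices with the most recent one first. \<open>Leaf s\<close> is a point that stands for the
  part \<open>s\<close>; \<open>Node l k r\<close> joins two arcs by an edge of length \<open>k\<close>; \<open>Pend t c s j\<close> is the arc of \<open>t\<close>, whose point \<open>c\<close>
  also stands for the parts \<open>i # s\<close> with \<open>i \<ge> j\<close>, for which no leaf has been inserted yet.
\<close>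

datatype tree = Leaf "nat list" | Node tree real tree | Pend tree real "nat list" nat

primrec len :: "tree \<Rightarrow> real" where
  "len (Leaf s) = 0"
| "len (Node l k r) = len l + k + len r"
| "len (Pend t c s j) = len t"

text \<open>Lets \<open>step\<close> reach the left child below a \<open>Pend\<close>, where
  primitive recursion offers only \<open>t\<close> and \<open>step t\<close>. For valid trees the
  argument is a \<open>Node\<close> there; the other values are defaults.\<close>

primrec left :: "tree \<Rightarrow> tree" where
  "left (Leaf s) = Leaf s"
| "left (Node l k r) = l"
| "left (Pend t c s j) = t"

primrec is_pend :: "tree \<Rightarrow> bool" where
  "is_pend (Leaf s) = False"
| "is_pend (Node l k r) = False"
| "is_pend (Pend t c s j) = True"

text \<open>The pending point lies strictly inside the top edge, so that it is no end point. Such an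
  edge exists only once two leaves are joined: hence \<open>step\<close> gives leaves to the parts 0
  and 1 before anything is pending, and takes 1/2, the midpoint of their edge of length 1.\<close>

primrec valid :: "tree \<Rightarrow> bool" where
  "valid (Leaf s) = True"
| "valid (Node l k r) = (valid l \<and> k > 0 \<and> valid r \<and> \<not> is_pend r)"
| "valid (Pend t c s j) = (valid t \<and> (\<exists>l k r. t = Node l k r \<and> len l < c \<and> c < len l + k))"

lemma continuous_on_ivl_glue:
  fixes f :: "real \<Rightarrow> real"
  assumes "continuous_on {a..b} f" "continuous_on {b..c} f"
  shows "continuous_on {a..c} f"
proof (cases "a \<le> b \<and> b \<le> c")
  case True
  then have "{a..c} = {a..b} \<union> {b..c}" by auto
  then show ?thesis using continuous_on_closed_Un[of "{a..b}" "{b..c}" f] assms by auto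
next
  case False
  then have "{a..c} \<subseteq> {a..b} \<or> {a..c} \<subseteq> {b..c}" by auto
  then show ?thesis using assms continuous_on_subset by blast
qed

text \<open>A Lusin scheme on the set \<open>P []\<close>, still without a topology. By
  \<open>P_initial\<close> the non-empty parts come first, so a single empty part tells
  \<open>step\<close> that none is left.\<close>

locale splitting =
  fixes P :: "nat list \<Rightarrow> 'a set"
  assumes P_split: "P s = (\<Union>j. P (j # s))"
    and P_disj: "i \<noteq> j \<Longrightarrow> P (i # s) \<inter> P (j # s) = {}"
    and P_initial: "P (Suc j # s) \<noteq> {} \<Longrightarrow> P (j # s) \<noteq> {}"
    and P_root: "P [] \<noteq> {}"
begin

text \<open>
  The value of the bonding map at the right end of its domain. It is not the right end of the
  arc precisely when a leaf for a pending part is inserted. This is why \<^const>\<open>valid\<close> excludes \<^const>\<open>Pend\<close>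
  as a right child: only ends that are joined to an edge may move.
\<close>

primrec end_value :: "tree \<Rightarrow> real" where
  "end_value (Leaf s) = 0"
| "end_value (Node l k r) = len l + k + end_value r"
| "end_value (Pend t c s j) = (if P (j # s) \<noteq> {} then c else end_value t)"

text \<open>
  The edge of a node is prolonged at both ends. To the left it runs from the image of the right end of \<open>l\<close>
  back through all of \<open>l\<close> to its left end and forth again, to the right it runs through all of \<open>r\<close> and back.
  The edge to a new leaf starts at the right end of \<open>t\<close>, runs to the left end of \<open>t\<close> and back to \<open>c\<close>.
\<close>

primrec step :: "tree \<Rightarrow> tree" where
  "step (Leaf s) =
     (if P (1 # s) = {} then Leaf (0 # s)
      else if P (2 # s) = {} then Node (Leaf (0 # s)) 1 (Leaf (1 # s))
      else Node (Pend (Node (Leaf (0 # s)) 1 (Leaf (1 # s))) (1/2) s 3) 1 (Leaf (2 # s)))"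
| "step (Node l k r) = Node (step l) (end_value l + len (Node l k r) + len r) (step r)"
| "step (Pend t c s j) =
     (let u = Pend (step t) (len (left (step t)) + end_value (left t) + c) s (Suc j)
      in if P (j # s) = {} then u else Node u (len t + c) (Leaf (j # s)))"

text \<open>On the edge, \<open>z\<close> is the distance from the point mapped to 0, and
  \<open>min z (2 * n - z)\<close> reflects at the right end \<open>n\<close>: the value runs from
  \<open>e\<close> down to 0, up to \<open>n\<close>, and down to
  \<open>n - len r = len l + k\<close>. In the last clause it runs from \<open>len t\<close> down to
  0 and up to \<open>c\<close>.\<close>

primrec bond :: "tree \<Rightarrow> real \<Rightarrow> real" where
  "bond (Leaf s) x = 0"
| "bond (Node l k r) x =
     (let a = len (step l); e = end_value l; n = len l + k + len r; b = a + e + n + len r; z = \<bar>x - a - e\<bar>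
      in if x \<le> a then bond l x else if x \<ge> b then len l + k + bond r (x - b) else min z (2 * n - z))"
| "bond (Pend t c s j) x = (if x \<le> len (step t) then bond t x else \<bar>len t + len (step t) - x\<bar>)"

section \<open>Lengths, range and continuity of the bonding maps\<close>

lemma len_nonneg: "valid t \<Longrightarrow> 0 \<le> len t"
  by (induction t) auto

lemma end_value_not_pend: "valid t \<Longrightarrow> \<not> is_pend t \<Longrightarrow> end_value t = len t"
  by (induction t) auto

lemma end_value_bounds: "valid t \<Longrightarrow> 0 \<le> end_value t \<and> end_value t \<le> len t"
proof (induction t)
  case (Pend t c s j)
  then obtain l k r where t: "t = Node l k r" "len l < c" "c < len l + k" "valid l" "valid r"
    by auto
  then show ?case using Pend len_nonneg[of l] len_nonneg[of r] by auto
qed (use len_nonneg in auto)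

text \<open>This is why \<open>step\<close> inserts the leaf of part 2 at once: the new
  \<open>Pend\<close> becomes a left child, and a leaf that is a right child is not replaced by a
  \<open>Pend\<close>.\<close>

lemma step_is_pend: "\<not> is_pend t \<Longrightarrow> \<not> is_pend (step t)"
  by (cases t) auto

lemma valid_step: "valid t \<Longrightarrow> valid (step t)"
proof (induction t)
  case (Node l k r)
  then show ?case
    using end_value_bounds[of l] len_nonneg[of l] len_nonneg[of r] step_is_pend by auto
next
  case (Pend t c s j)
  then obtain l k r where t: "t = Node l k r" "len l < c" "c < len l + k" "valid l" "valid r" "k > 0"
    by auto
  have "0 \<le> end_value l" "0 \<le> len l" "0 \<le> len r"
    using t end_value_bounds len_nonneg by blast+
  with t Pend show ?case by (auto simp: Let_def)
qed auto

lemma len_step_pos: "valid t \<Longrightarrow> 0 \<le> len (step t)"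
  using valid_step len_nonneg by blast

lemma bond_zero: "valid t \<Longrightarrow> bond t 0 = 0"
proof (induction t)
qed (auto simp: Let_def len_step_pos)

lemma bond_end: "valid t \<Longrightarrow> bond t (len (step t)) = end_value t"
proof (induction t)
  case (Node l k r)
  have "0 \<le> len (step r)" "0 \<le> end_value l" "0 \<le> len l" "0 \<le> len r"
    using Node len_step_pos end_value_bounds len_nonneg by auto
  with Node show ?case by (auto simp: Let_def algebra_simps)
next
  case (Pend t c s j)
  then obtain l k r where t: "t = Node l k r" "len l < c" "c < len l + k" "valid l" "valid r" "k > 0" "valid t"
    by auto
  have "0 < len t" "0 \<le> len l" using t len_nonneg by (auto simp: add_nonneg_pos add_pos_nonneg)
  with Pend t(2) show ?case by (auto simp: Let_def)
qed auto

lemma bond_range: "valid t \<Longrightarrow> 0 \<le> x \<Longrightarrow> x \<le> len (step t) \<Longrightarrow> 0 \<le> bond t x \<and> bond t x \<le> len t"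
proof (induction t arbitrary: x)
  case (Node l k r)
  define a n b where "a = len (step l)" and "n = len l + k + len r" and "b = a + end_value l + n + len r"
  have bd: "0 \<le> len (step l)" "0 \<le> len (step r)" "0 \<le> end_value l" "end_value l \<le> len l" "0 \<le> len l" "0 \<le> len r" "k > 0"
    using Node len_step_pos end_value_bounds len_nonneg by auto
  consider "x \<le> a" | "x > a" "x \<ge> b" | "a < x" "x < b" by linarith
  then show ?case
  proof cases
    case 1
    then show ?thesis using Node.IH(1)[of x] Node.prems bd by (auto simp: Let_def a_def)
  next
    case 2
    have "bond (Node l k r) x = len l + k + bond r (x - b)"
      using 2 by (auto simp: Let_def a_def b_def n_def)
    moreover have "0 \<le> bond r (x - b) \<and> bond r (x - b) \<le> len r"
      using Node.IH(2)[of "x - b"] Node.prems 2 by (auto simp: a_def b_def n_def algebra_simps)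
    ultimately show ?thesis using bd by auto
  next
    case 3
    then have "bond (Node l k r) x = min \<bar>x - a - end_value l\<bar> (2 * n - \<bar>x - a - end_value l\<bar>)"
      by (auto simp: Let_def a_def b_def n_def)
    moreover have "\<bar>x - a - end_value l\<bar> \<le> n + len r" using 3 bd by (auto simp: b_def n_def abs_le_iff)
    ultimately show ?thesis using bd by (auto simp: n_def min_def)
  qed
next
  case (Pend t c s j)
  then obtain l k r where t: "t = Node l k r" "len l < c" "c < len l + k" "valid l" "valid r" "k > 0" "valid t"
    by auto
  have "0 \<le> len l" "0 \<le> len r" using t len_nonneg by auto
  then have "c < len t" "0 < c" using t by auto
  with Pend show ?case by (auto simp: Let_def split: if_splits)
qed auto

lemma continuous_on_bond: "valid t \<Longrightarrow> continuous_on {0..len (step t)} (bond t)"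
proof (induction t)
  case (Node l k r)
  define a n e b where "a = len (step l)" and "n = len l + k + len r" and "e = end_value l" and "b = a + e + n + len r"
  have bd: "0 \<le> a" "0 \<le> len (step r)" "0 \<le> e" "e \<le> len l" "0 \<le> len l" "0 \<le> len r" "k > 0"
    using Node len_step_pos end_value_bounds len_nonneg by (auto simp: a_def e_def)
  have len: "len (step (Node l k r)) = b + len (step r)" by (simp add: a_def b_def n_def e_def)
  have 1: "continuous_on {0..a} (bond (Node l k r))"
    using Node by (subst continuous_on_cong[OF refl, where g = "bond l"]) (auto simp: Let_def a_def)
  \<comment> \<open>The middle formula persists at both joints: it gives \<open>e\<close> at
    \<open>a\<close>, matching \<open>bond_end\<close>, and \<open>len l + k\<close> at
    \<open>b\<close>, matching \<open>bond_zero\<close>.\<close>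
  have "bond (Node l k r) x = min \<bar>x - a - e\<bar> (2 * n - \<bar>x - a - e\<bar>)" if "x \<in> {a..b}" for x
  proof -
    consider "x = a" | "a < x" "x < b" | "x \<noteq> a" "x = b" using \<open>x \<in> {a..b}\<close> by force
    then show ?thesis
    proof cases
      case 1
      then have "bond (Node l k r) x = e" using bond_end Node.prems by (auto simp: Let_def a_def e_def)
      then show ?thesis using 1 bd by (auto simp: n_def)
    next
      case 2
      then show ?thesis by (auto simp: Let_def a_def b_def n_def e_def)
    next
      case 3
      then have "bond (Node l k r) x = len l + k"
        using bond_zero Node.prems that by (auto simp: Let_def a_def b_def n_def e_def)
      then show ?thesis using 3 bd by (auto simp: b_def n_def)
    qed
  qed
  then have "continuous_on {a..b} (bond (Node l k r)) \<longleftrightarrow> 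
     continuous_on {a..b} (\<lambda>x. min \<bar>x - a - e\<bar> (2 * n - \<bar>x - a - e\<bar>))"
    by (intro continuous_on_cong refl) blast
  then have 2: "continuous_on {a..b} (bond (Node l k r))"
    by (simp add: continuous_intros)
  have ab: "a < b" using bd by (auto simp: b_def n_def)
  have "continuous_on {b..b + len (step r)} (\<lambda>x. bond r (x - b))"
    by (rule continuous_on_compose2[of "{0..len (step r)}" "bond r" _ "\<lambda>x. x - b"])
       (use Node in \<open>auto intro!: continuous_intros\<close>)
  then have "continuous_on {b..b + len (step r)} (\<lambda>x. len l + k + bond r (x - b))"
    by (intro continuous_intros)
  then have 3: "continuous_on {b..b + len (step r)} (bond (Node l k r))"
    using ab by (subst continuous_on_cong[OF refl, where g = "\<lambda>x. len l + k + bond r (x - b)"])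
      (auto simp: Let_def a_def b_def n_def e_def)
  show ?case
    unfolding len using continuous_on_ivl_glue[OF continuous_on_ivl_glue[OF 1 2] 3] .
next
  case (Pend t c s j)
  then obtain l k r where t: "t = Node l k r" "len l < c" "c < len l + k" "valid t" "valid l" "valid r" "\<not> is_pend r"
    by auto
  define M where "M = len (step t)"
  have 1: "continuous_on {0..M} (bond (Pend t c s j))"
    using Pend t by (subst continuous_on_cong[OF refl, where g = "bond t"]) (auto simp: M_def)
  \<comment> \<open>The tree under a \<open>Pend\<close> is a \<open>Node\<close>, so its right end
    is mapped to \<open>len t\<close>, where the new edge starts.\<close>
  have "bond (Pend t c s j) x = \<bar>len t + M - x\<bar>" if "x \<in> {M..M + len t + c}" for x
    using that bond_end[OF t(4)] end_value_not_pend[OF t(4)] len_nonneg[OF t(4)] by (cases "x = M") (auto simp: M_def t(1))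
  then have "continuous_on {M..M + len t + c} (bond (Pend t c s j)) \<longleftrightarrow>
    continuous_on {M..M + len t + c} (\<lambda>x. \<bar>len t + M - x\<bar>)"
    by (intro continuous_on_cong refl) blast
  then have 2: "continuous_on {M..M + len t + c} (bond (Pend t c s j))"
    by (simp add: continuous_intros)
  show ?case
    using 1 continuous_on_ivl_glue[OF 1 2] by (auto simp: Let_def M_def algebra_simps)
qed auto

section \<open>The parts carried by a tree and their positions\<close>

primrec content :: "tree \<Rightarrow> 'a set" where
  "content (Leaf s) = P s"
| "content (Node l k r) = content l \<union> content r"
| "content (Pend t c s j) = content t \<union> (\<Union>i\<in>{j..}. P (i # s))"

primrec separated :: "tree \<Rightarrow> bool" where
  "separated (Leaf s) = True"
| "separated (Node l k r) = (separated l \<and> separated r \<and> content l \<inter> content r = {})"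
| "separated (Pend t c s j) = (separated t \<and> content t \<inter> (\<Union>i\<in>{j..}. P (i # s)) = {})"

text \<open>The coordinate of the point that stands for the part containing \<open>x\<close>.
  Outside the content the value is a default, so that bounds and continuity need no side
  condition.\<close>

primrec place :: "tree \<Rightarrow> 'a \<Rightarrow> real" where
  "place (Leaf s) x = 0"
| "place (Node l k r) x = (if x \<in> content l then place l x else len l + k + place r x)"
| "place (Pend t c s j) x = (if x \<in> content t then place t x else c)"

lemma P_empty_mono:
  assumes "P (i # s) = {}" "i \<le> j"
  shows "P (j # s) = {}"
  using assms(2) by (induction rule: dec_induct) (use assms(1) P_initial in blast)+

lemma P_same_index: "x \<in> P (i # s) \<Longrightarrow> x \<in> P (j # s) \<Longrightarrow> i = j"
  using P_disj by blast

lemma P_split_first: "P s = (\<Union>i<n. P (i # s)) \<union> (\<Union>i\<in>{n..}. P (i # s))"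
proof -
  have *: "{..<n} \<union> {n..} = (UNIV :: nat set)" by auto
  show ?thesis unfolding P_split[of s] UN_Un[symmetric] * ..
qed

lemma P_later_first: "(\<Union>i\<in>{n..}. P (i # s)) = P (n # s) \<union> (\<Union>i\<in>{Suc n..}. P (i # s))"
proof -
  have "{n..} = insert n {Suc n..}" by auto
  then show ?thesis by simp
qed

lemma P_later_empty: "P (n # s) = {} \<Longrightarrow> (\<Union>i\<in>{n..}. P (i # s)) = {}"
  using P_empty_mono by blast

lemma content_step: "content (step t) = content t"
proof (induction t)
  case (Leaf s)
  have "{..<3} = {0, 1, 2::nat}" by auto
  then have "P s = P (0 # s) \<union> (P (1 # s) \<union> (P (2 # s) \<union> (\<Union>i\<in>{3..}. P (i # s))))"
    using P_split_first[of s 3] by auto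
  moreover have "P (2 # s) = {}" if "P (1 # s) = {}"
    using that P_empty_mono[of 1 s 2] by simp
  moreover have "(\<Union>i\<in>{3..}. P (i # s)) = {}" if "P (2 # s) = {}"
    using P_later_empty[of 3 s] P_empty_mono[of 2 s 3] that by simp
  ultimately show ?case
    by (cases "P (1 # s) = {}"; cases "P (2 # s) = {}") (simp_all add: Un_ac)
next
  case (Pend t c s j)
  then show ?case
    using P_later_first[of s j] P_later_empty[of j s] by (auto simp: Let_def)
qed auto

lemma separated_step: "separated t \<Longrightarrow> separated (step t)"
proof (induction t)
  case (Leaf s)
  then show ?case by (auto dest: P_same_index)
next
  case (Pend t c s j)
  have "P (j # s) \<inter> (\<Union>i\<in>{Suc j..}. P (i # s)) = {}" by (auto dest: P_same_index)
  then show ?case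
    using Pend P_later_first[of s j] P_later_empty[of j s] by (auto simp: Let_def content_step)
qed (auto simp: content_step)

lemma place_bounds: "valid t \<Longrightarrow> 0 \<le> place t x \<and> place t x \<le> len t"
proof (induction t)
  case (Node l k r)
  then show ?case using len_nonneg[of l] len_nonneg[of r] by auto
next
  case (Pend t c s j)
  then obtain l k r where t: "t = Node l k r" "len l < c" "c < len l + k" "valid l" "valid r" "k > 0" "valid t"
    by auto
  have "0 \<le> len l" "0 \<le> len r" using t len_nonneg by auto
  with t Pend show ?case by auto
qed auto

lemma bond_node_right:
  assumes "valid (Node l k r)" "0 \<le> y"
  shows "bond (Node l k r) (len (step l) + (end_value l + len (Node l k r) + len r) + y) = len l + k + bond r y"
proof -
  have "end_value l + len (Node l k r) + len r > 0"
    using assms end_value_bounds[of l] len_nonneg[of l] len_nonneg[of r] by auto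
  then show ?thesis using assms by (auto simp: Let_def algebra_simps)
qed

text \<open>On the ascending run the bonding map is a translation onto the whole arc. The two
  special cases are the joints with the children, where another clause of \<open>bond\<close>
  applies.\<close>

lemma bond_node_ascent:
  assumes "valid (Node l k r)" "0 \<le> y" "y \<le> len (Node l k r)"
  shows "bond (Node l k r) (len (step l) + end_value l + y) = y"
proof -
  have bd: "0 \<le> end_value l" "0 \<le> len r" "end_value l \<le> len l" "0 \<le> len l"
    using assms end_value_bounds[of l] len_nonneg[of l] len_nonneg[of r] by auto
  show ?thesis
  proof (cases "end_value l + y = 0")
    case True
    then have "end_value l = 0" "y = 0" using bd assms(2) by linarith+
    then show ?thesis using bd assms bond_zero bond_end[of l] by (auto simp: Let_def)
  next
    case place: False
    show ?thesis
    proof (cases "len l + k + 2 * len r = y")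
      case True
      then have "len r = 0" "y = len l + k" using assms(3) bd by auto
      then show ?thesis using place bd assms bond_zero[of r] by (auto simp: Let_def)
    next
      case False
      then show ?thesis using place bd assms by (auto simp: Let_def)
    qed
  qed
qed

text \<open>This makes the positions of \<open>x\<close> a point of the inverse limit. For a pending
  part either the new leaf sits at the right end, which is mapped to \<open>c\<close>, or the
  pending point moves to a preimage of \<open>c\<close>.\<close>

lemma bond_place_step: "valid t \<Longrightarrow> x \<in> content t \<Longrightarrow> bond t (place (step t) x) = place t x"
proof (induction t)
  case (Leaf s)
  then show ?case by simp
next
  case (Node l k r)
  show ?case
  proof (cases "x \<in> content l")
    case True
    then show ?thesis using Node place_bounds[of "step l" x] valid_step[of l] by (auto simp: content_step Let_def)
  next
    case False
    then show ?thesis using Node place_bounds[of "step r" x] valid_step[of r]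
        bond_node_right[of l k r "place (step r) x"] by (auto simp: content_step simp del: bond.simps)
  qed
next
  case (Pend t c s j)
  then obtain l k r where t: "t = Node l k r" "len l < c" "c < len l + k" "valid l" "valid r" "k > 0" "valid t"
    by auto
  have bd: "0 \<le> len l" "0 \<le> len r" "0 \<le> end_value l" using t len_nonneg end_value_bounds by auto
  \<comment> \<open>The new pending coordinate chosen by \<open>step\<close> is the preimage of
    \<open>c\<close> on the ascending run of the top edge of \<open>t\<close>.\<close>
  define q where "q = len (left (step t)) + end_value (left t) + c"
  have q: "q = len (step l) + end_value l + c" by (simp add: t(1) q_def)
  have c_pos: "0 < c" "0 < len t" "c \<le> len (Node l k r)" using t bd by auto
  have q_le: "q \<le> len (step t)" using t(1,2,3) bd len_step_pos[of r] \<open>valid r\<close> by (simp add: q)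
  have Fq: "bond t q = c"
    unfolding q t(1) by (rule bond_node_ascent) (use t c_pos in auto)
  have pt: "place (step t) x \<le> len (step t)" using place_bounds valid_step[OF t(7)] by auto
  show ?case
  proof (cases "x \<in> content t")
    case True
    then show ?thesis using Pend t(7) pt by (auto simp: Let_def content_step)
  next
    case False
    show ?thesis
    proof (cases "x \<in> P (j # s)")
      case True
      then have "x \<notin> (\<Union>i\<in>{Suc j..}. P (i # s))" by (auto dest: P_same_index)
      then show ?thesis using True False Pend.prems c_pos by (auto simp: Let_def content_step)
    next
      case bond: False
      then have "x \<in> (\<Union>i\<in>{Suc j..}. P (i # s))" using False Pend P_later_first[of s j] by auto
      then show ?thesis using bond False q_le Fq by (auto simp: Let_def q_def content_step)
    qed
  qed
qed

text \<open>
  The part containing \<open>x\<close> that has a leaf or is the next to get one, and the number of stages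
  until it has one.
\<close>

primrec label_at :: "tree \<Rightarrow> 'a \<Rightarrow> nat list" where
  "label_at (Leaf s) x = s"
| "label_at (Node l k r) x = (if x \<in> content l then label_at l x else label_at r x)"
| "label_at (Pend t c s j) x = (if x \<in> content t then label_at t x else (THE i. x \<in> P (i # s)) # s)"

primrec delay :: "tree \<Rightarrow> 'a \<Rightarrow> nat" where
  "delay (Leaf s) x = 0"
| "delay (Node l k r) x = (if x \<in> content l then delay l x else delay r x)"
| "delay (Pend t c s j) x = (if x \<in> content t then delay t x else Suc (THE i. x \<in> P (i # s)) - j)"

lemma the_index: "x \<in> P (i # s) \<Longrightarrow> (THE i. x \<in> P (i # s)) = i"
  using P_same_index by blast

lemma label_at_mem: "x \<in> content t \<Longrightarrow> x \<in> P (label_at t x)"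
proof (induction t)
  case (Pend t c s j)
  then show ?case by (auto simp: the_index)
qed auto

lemma delay_Suc: "x \<in> content t \<Longrightarrow> delay t x = Suc d \<Longrightarrow> delay (step t) x = d \<and> label_at (step t) x = label_at t x"
proof (induction t)
  case (Pend t c s j)
  show ?case
  proof (cases "x \<in> content t")
    case True
    then show ?thesis using Pend by (auto simp: Let_def content_step)
  next
    case False
    then obtain i where i: "x \<in> P (i # s)" "j \<le> i" using Pend by auto
    have "i \<noteq> j \<Longrightarrow> x \<notin> P (j # s)" using i P_same_index by blast
    moreover have "i = j \<Longrightarrow> x \<notin> (\<Union>i\<in>{Suc j..}. P (i # s))" using i P_same_index by fastforce
    moreover have "i \<noteq> j \<Longrightarrow> x \<in> (\<Union>i\<in>{Suc j..}. P (i # s))" using i by force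
    \<comment> \<open>Part \<open>j\<close> receives its leaf in this very step, so its delay is
      \<open>Suc j - j = 1\<close>; each later part waits one stage longer than its
      predecessor.\<close>
    moreover have "d = i - j" using Pend.prems False i by (simp add: the_index)
    ultimately show ?thesis
      using False i by (cases "i = j") (auto simp: Let_def content_step the_index)
  qed
qed (auto simp: content_step)

lemma delay_0: "x \<in> content t \<Longrightarrow> delay t x = 0 \<Longrightarrow> length (label_at (step t) x) = Suc (length (label_at t x))"
proof (induction t)
  case (Pend t c s j)
  have "x \<in> content t" using Pend.prems by (auto simp: the_index split: if_splits)
  then show ?case using Pend by (auto simp: Let_def content_step)
qed (auto simp: content_step)

lemma content_step_iter: "content ((step ^^ n) t) = content t"
  by (induction n) (auto simp: content_step)

text \<open>The delay counts down to 0 while the label stays fixed, and a step taken at a leaf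
  lengthens the label by one.\<close>

lemma label_at_unbounded:
  assumes "x \<in> content t"
  shows "\<exists>n. delay ((step ^^ n) t) x = 0 \<and> i \<le> length (label_at ((step ^^ n) t) x)"
proof -
  have reach: "\<exists>m. delay ((step ^^ m) u) x = 0 \<and> label_at ((step ^^ m) u) x = label_at u x" if "x \<in> content u" for u
    using that
  proof (induction "delay u x" arbitrary: u)
    case 0
    then show ?case by (metis funpow_0)
  next
    case (Suc d)
    then have "delay (step u) x = d" "label_at (step u) x = label_at u x" "x \<in> content (step u)"
      using delay_Suc[of x u d] content_step by auto
    with Suc(1)[of "step u"] obtain m where "delay ((step ^^ m) (step u)) x = 0 \<and> label_at ((step ^^ m) (step u)) x = label_at u x"
      by auto
    then show ?case by (metis funpow_Suc_right comp_apply)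
  qed
  show ?thesis
  proof (induction i)
    case 0
    then show ?case using reach[OF assms] by auto
  next
    case (Suc i)
    then obtain n where n: "delay ((step ^^ n) t) x = 0" "i \<le> length (label_at ((step ^^ n) t) x)" by auto
    have x: "x \<in> content ((step ^^ k) t)" for k using assms content_step_iter by auto
    obtain m where m: "delay ((step ^^ m) ((step ^^ Suc n) t)) x = 0"
      "label_at ((step ^^ m) ((step ^^ Suc n) t)) x = label_at ((step ^^ Suc n) t) x" using reach x by blast
    have "Suc i \<le> length (label_at ((step ^^ Suc n) t) x)" using delay_0[OF x n(1)] n(2) by simp
    with m show ?case by (metis funpow_add comp_apply)
  qed
qed

text \<open>
  \<open>occurs t p u q\<close>: the arc of \<open>u\<close> is a part of the arc of \<open>t\<close> with offset \<open>p\<close>, and the arc of \<open>step u\<close> is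
  the corresponding part of \<open>step t\<close> with offset \<open>q\<close>.
\<close>

inductive occurs :: "tree \<Rightarrow> real \<Rightarrow> tree \<Rightarrow> real \<Rightarrow> bool" where
  refl: "occurs t 0 t 0"
| left: "occurs l p u q \<Longrightarrow> occurs (Node l k r) p u q"
| right: "occurs r p u q \<Longrightarrow> occurs (Node l k r) (len l + k + p) u
    (len (step l) + (end_value l + len (Node l k r) + len r) + q)"
| pend: "occurs t p u q \<Longrightarrow> occurs (Pend t c s j) p u q"

lemma occurs_trans: "occurs t p u q \<Longrightarrow> occurs u p' w q' \<Longrightarrow> occurs t (p + p') w (q + q')"
proof (induction rule: occurs.induct)
  case (refl t)
  then show ?case by simp
next
  case (left l p u q k r)
  then show ?case by (blast intro: occurs.left)
next
  case (right r p u q l k)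
  then show ?case using occurs.right[of r "p + p'" w "q + q'" l k] by (simp only: add.assoc)
next
  case (pend t p u q c s j)
  then show ?case by (blast intro: occurs.pend)
qed

lemma occurs_left: "occurs t p (Node l k r) q \<Longrightarrow> occurs t p l q"
  using occurs_trans[OF _ occurs.left[OF occurs.refl[of l], of k r], of t p q] by simp

lemma occurs_pend: "occurs t p (Pend u c s j) q \<Longrightarrow> occurs t p u q"
  using occurs_trans[OF _ occurs.pend[OF occurs.refl[of u], of c s j], of t p q] by simp

lemma occurs_right: "occurs t p (Node l k r) q \<Longrightarrow>
   occurs t (p + len l + k) r (q + len (step l) + (end_value l + len (Node l k r) + len r))"
  using occurs_trans[OF _ occurs.right[OF occurs.refl[of r], of l k], of t p q] by (simp add: add.assoc)

lemma occurs_valid: "occurs t p u q \<Longrightarrow> valid t \<Longrightarrow> valid u"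
  by (induction rule: occurs.induct) auto

lemma occurs_bounds: "occurs t p u q \<Longrightarrow> valid t \<Longrightarrow> 0 \<le> p \<and> p + len u \<le> len t \<and> 0 \<le> q \<and> q + len (step u) \<le> len (step t)"
proof (induction rule: occurs.induct)
  case (left l p u q k r)
  have "0 \<le> len r" "0 \<le> len (step r)" "0 \<le> len l" "0 \<le> end_value l"
    using left len_nonneg len_step_pos end_value_bounds by auto
  with left show ?case by auto
next
  case (right r p u q l k)
  have "0 \<le> len r" "0 \<le> len (step r)" "0 \<le> len l" "0 \<le> end_value l" "0 \<le> len (step l)"
    using right len_nonneg len_step_pos end_value_bounds by auto
  with right show ?case by auto
next
  case (pend t p u q c s j)
  then obtain l k r where t: "t = Node l k r" "len l < c" "valid l" "valid t" by auto
  then have "0 \<le> len l" "0 \<le> len t" using len_nonneg by auto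
  with t pend show ?case by (auto simp: Let_def)
qed auto

lemma bond_occurs: "occurs t p u q \<Longrightarrow> valid t \<Longrightarrow> 0 \<le> x \<Longrightarrow> x \<le> len (step u) \<Longrightarrow> bond t (q + x) = p + bond u x"
proof (induction rule: occurs.induct)
  case (left l p u q k r)
  then show ?case using occurs_bounds[OF left(1)] by (auto simp: Let_def)
next
  case (right r p u q l k)
  then show ?case using occurs_bounds[OF right(1)] bond_node_right[of l k r "q + x"]
    by (simp add: add.assoc)
next
  case (pend t p u q c s j)
  then show ?case using occurs_bounds[OF pend(1)] by auto
qed auto

lemma place_occurs: "occurs t p u q \<Longrightarrow> separated t \<Longrightarrow> x \<in> content u \<Longrightarrow>
    x \<in> content t \<and> place t x = p + place u x \<and> place (step t) x = q + place (step u) x"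
proof (induction rule: occurs.induct)
  case (right r p u q l k)
  then show ?case by (auto simp: content_step)
next
  case (pend t p u q c s j)
  then show ?case by (auto simp: content_step Let_def)
qed (auto simp: content_step)

text \<open>Edges have positive length and pending points lie strictly inside them, so the
  coordinate of a leaf is shared by no other leaf and no pending point. This is what lets one
  coordinate identify a part.\<close>

lemma occurs_leaf_unique: "occurs t p u q \<Longrightarrow> u = Leaf s \<Longrightarrow> valid t \<Longrightarrow> x \<in> content t \<Longrightarrow> place t x = p \<Longrightarrow> x \<in> P s"
proof (induction rule: occurs.induct)
  case (left l p u q k r)
  have "p \<le> len l" using occurs_bounds[OF left(1)] left len_nonneg by auto
  moreover have "0 \<le> place r x" using place_bounds left by auto
  ultimately show ?case using left by (auto split: if_splits)
next
  case (right r p u q l k)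
  have "0 \<le> p" using occurs_bounds[OF right(1)] right len_nonneg by auto
  moreover have "place l x \<le> len l" using place_bounds right by auto
  ultimately show ?case using right by (auto split: if_splits)
next
  case (pend t p u q c s' j)
  then obtain l k r where t: "t = Node l k r" "len l < c" "c < len l + k" "valid t" "valid l" "valid r" by auto
  have "p \<noteq> c"
    using pend(1) unfolding t(1)
  proof (cases rule: occurs.cases)
    case refl
    then show ?thesis using pend by auto
  next
    case left
    then show ?thesis using occurs_bounds[of l p u q] t pend(3) by auto
  next
    case (right p q)
    then show ?thesis using occurs_bounds[of r p u q] t by auto
  qed
  then show ?case using pend t by (auto split: if_splits)
qed auto

lemma delay_0_occurs: "x \<in> content t \<Longrightarrow> delay t x = 0 \<Longrightarrow> \<exists>q. occurs t (place t x) (Leaf (label_at t x)) q"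
proof (induction t)
  case (Leaf s)
  then show ?case using occurs.refl[of "Leaf s"] by auto
next
  case (Node l k r)
  show ?case
  proof (cases "x \<in> content l")
    case True
    then obtain q where "occurs l (place l x) (Leaf (label_at l x)) q" using Node by auto
    then show ?thesis using True occurs.left[of l "place l x" "Leaf (label_at l x)" q k r] by auto
  next
    case False
    then obtain q where "occurs r (place r x) (Leaf (label_at r x)) q" using Node by auto
    then show ?thesis using False occurs.right[of r "place r x" "Leaf (label_at r x)" q l k] by (auto simp del: len.simps)
  qed
next
  case (Pend t c s j)
  have "x \<in> content t" using Pend.prems by (auto simp: the_index split: if_splits)
  then obtain q where "occurs t (place t x) (Leaf (label_at t x)) q" using Pend by auto
  then show ?case using \<open>x \<in> content t\<close> occurs.pend[of t "place t x" "Leaf (label_at t x)" q c s j] by auto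
qed

text \<open>The preimage, under the bonding map, of a point of an edge in the prolongation of this edge.\<close>

primrec edge_lift :: "tree \<Rightarrow> real \<Rightarrow> real" where
  "edge_lift (Leaf s) x = 0"
| "edge_lift (Node l k r) x =
     (if x \<le> len l then edge_lift l x
      else if x \<ge> len l + k then len (step l) + (end_value l + len (Node l k r) + len r) + edge_lift r (x - (len l + k))
      else len (step l) + end_value l + x)"
| "edge_lift (Pend t c s j) x = edge_lift t x"

text \<open>The lift uses only the whole tree and the coordinate, not the node in question. A
  coordinate on an edge therefore determines the next one, wherever the node occurs.\<close>

lemma edge_lift_occurs: "occurs t p u q \<Longrightarrow> u = Node l k r \<Longrightarrow> valid t \<Longrightarrow> len l < y \<Longrightarrow> y < len l + k \<Longrightarrow>
    edge_lift t (p + y) = q + (len (step l) + end_value l + y)"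
proof (induction rule: occurs.induct)
  case (left l' p u q k' r')
  have "p + y \<le> len l'" using occurs_bounds[OF left(1)] left occurs_valid[OF left(1)] len_nonneg[of r] by auto
  then show ?case using left by auto
next
  case (right r' p u q l' k')
  have "0 \<le> p + y" using occurs_bounds[OF right(1)] right occurs_valid[OF right(1)] len_nonneg[of l] by auto
  then show ?case using right by auto
qed auto

text \<open>Only the ascending run takes values strictly inside the edge: the left child and the
  first run stay at or below \<open>len l\<close>, the right child and the last run at or above
  \<open>len l + k\<close>.\<close>

lemma bond_node_inv:
  assumes v: "valid (Node l k r)" and x: "0 \<le> x" "x \<le> len (step (Node l k r))"
    and bond: "len l < bond (Node l k r) x" "bond (Node l k r) x < len l + k"
  shows "x = len (step l) + end_value l + bond (Node l k r) x"
proof -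
  define a n e b where "a = len (step l)" and "n = len l + k + len r" and "e = end_value l" and "b = a + e + n + len r"
  have bd: "0 \<le> a" "0 \<le> len (step r)" "0 \<le> e" "e \<le> len l" "0 \<le> len l" "0 \<le> len r" "k > 0"
    using v len_step_pos end_value_bounds len_nonneg by (auto simp: a_def e_def)
  consider "x \<le> a" | "x > a" "x \<ge> b" | "a < x" "x < b" by linarith
  then show ?thesis
  proof cases
    case 1
    then have "bond (Node l k r) x \<le> len l" using bond_range[of l x] v x by (auto simp: a_def)
    with bond show ?thesis by simp
  next
    case 2
    then have "bond (Node l k r) x = len l + k + bond r (x - b)"
      by (auto simp: Let_def a_def b_def n_def e_def)
    moreover have "0 \<le> bond r (x - b)" using bond_range[of r "x - b"] v x 2 by (auto simp: a_def b_def n_def e_def algebra_simps)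
    ultimately show ?thesis using bond by simp
  next
    case 3
    then have "bond (Node l k r) x = min \<bar>x - a - e\<bar> (2 * n - \<bar>x - a - e\<bar>)"
      by (auto simp: Let_def a_def b_def n_def e_def)
    then have "bond (Node l k r) x = x - a - e" using bond 3 bd by (auto simp: min_def n_def b_def split: if_splits)
    then show ?thesis by (simp add: a_def e_def)
  qed
qed

text \<open>Together with \<open>bond_node_upper\<close> this shows that the bonding maps respect
  the two sides of a point of an edge, so each side is an inverse limit of subarcs. The first run
  stays below \<open>y\<close> because it starts at \<open>end_value l\<close>, which is at most
  \<open>len l\<close>.\<close>

lemma bond_node_lower:
  assumes v: "valid (Node l k r)" and x: "0 \<le> x" "x \<le> len (step l) + end_value l + y"
    and y: "len l \<le> y" "y \<le> len l + k"
  shows "bond (Node l k r) x \<le> y"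
proof -
  define a n e b where "a = len (step l)" and "n = len l + k + len r" and "e = end_value l" and "b = a + e + n + len r"
  have bd: "0 \<le> a" "0 \<le> len (step r)" "0 \<le> e" "e \<le> len l" "0 \<le> len l" "0 \<le> len r" "k > 0"
    using v len_step_pos end_value_bounds len_nonneg by (auto simp: a_def e_def)
  consider "x \<le> a" | "x > a" "x = b" | "a < x" "x < b" 
    using x y bd by (auto simp: a_def[symmetric] e_def[symmetric] b_def n_def) linarith
  then show ?thesis
  proof cases
    case 1
    then have "bond (Node l k r) x \<le> len l" using bond_range[of l x] v x by (auto simp: a_def)
    with y show ?thesis by simp
  next
    case 2
    then have "bond (Node l k r) x = len l + k" using bond_zero[of r] v
      by (auto simp: Let_def a_def b_def n_def e_def)
    moreover have "y = len l + k" using 2 x y bd by (auto simp: b_def a_def e_def n_def)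
    ultimately show ?thesis by simp
  next
    case 3
    then have "bond (Node l k r) x = min \<bar>x - a - e\<bar> (2 * n - \<bar>x - a - e\<bar>)"
      by (auto simp: Let_def a_def b_def n_def e_def)
    moreover have "\<bar>x - a - e\<bar> \<le> y" using 3 x y bd by (auto simp: a_def e_def)
    ultimately show ?thesis by auto
  qed
qed

lemma bond_node_upper:
  assumes v: "valid (Node l k r)" and x: "len (step l) + end_value l + y \<le> x" "x \<le> len (step (Node l k r))"
    and y: "len l \<le> y" "y \<le> len l + k"
  shows "y \<le> bond (Node l k r) x"
proof -
  define a n e b where "a = len (step l)" and "n = len l + k + len r" and "e = end_value l" and "b = a + e + n + len r"
  have bd: "0 \<le> a" "0 \<le> len (step r)" "0 \<le> e" "e \<le> len l" "0 \<le> len l" "0 \<le> len r" "k > 0"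
    using v len_step_pos end_value_bounds len_nonneg by (auto simp: a_def e_def)
  consider "x = a" "e = 0" "y = 0" | "x > a" "x \<ge> b" | "a < x" "x < b"
    using x y bd by (force simp: a_def[symmetric] e_def[symmetric])
  then show ?thesis
  proof cases
    case 1
    then show ?thesis using bond_range[of "Node l k r" x] v x bd by auto
  next
    case 2
    then have "bond (Node l k r) x = len l + k + bond r (x - b)"
      by (auto simp: Let_def a_def b_def n_def e_def)
    moreover have "0 \<le> bond r (x - b)" using bond_range[of r "x - b"] v x 2 by (auto simp: a_def b_def n_def e_def algebra_simps)
    ultimately show ?thesis using y by simp
  next
    case 3
    then have "bond (Node l k r) x = min \<bar>x - a - e\<bar> (2 * n - \<bar>x - a - e\<bar>)"
      by (auto simp: Let_def a_def b_def n_def e_def)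
    then show ?thesis using 3 x y bd by (auto simp: min_def n_def b_def a_def e_def)
  qed
qed

end

subsection \<open>Folding the bonding maps\<close>

text \<open>
  \<open>g\<close> maps \<open>[0, M]\<close> into an arc \<open>[0, b]\<close> starting at the image of \<open>p\<close>, and \<open>f\<close> factors through \<open>g\<close>. For the
  induction, the second factor has to run straight through the whole of \<open>[0, N]\<close> on its last segment
  \<open>[b - N, b]\<close>, upwards or downwards, and both ends of \<open>[0, M]\<close> have to be mapped to this segment.
\<close>

definition folds :: "real \<Rightarrow> real \<Rightarrow> (real \<Rightarrow> real) \<Rightarrow> real \<Rightarrow> bool \<Rightarrow> real \<Rightarrow> (real \<Rightarrow> real) \<Rightarrow> bool" where
  "folds N M f p up b g \<longleftrightarrow>
     continuous_on {0..M} g \<and> g p = 0 \<and> (\<forall>x\<in>{0..M}. 0 \<le> g x \<and> g x \<le> b) \<and> N \<le> b \<and>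
     (\<forall>x\<in>{0..M}. \<forall>y\<in>{0..M}. g x = g y \<longrightarrow> f x = f y) \<and>
     (\<forall>x\<in>{0..M}. b - N \<le> g x \<longrightarrow> f x = (if up then g x - (b - N) else b - g x)) \<and>
     b - N \<le> g 0 \<and> b - N \<le> g M"

lemma foldsI:
  assumes "continuous_on {0..M} g" "g p = 0" "\<And>x. x \<in> {0..M} \<Longrightarrow> 0 \<le> g x \<and> g x \<le> b" "N \<le> b"
    "\<And>x y. x \<in> {0..M} \<Longrightarrow> y \<in> {0..M} \<Longrightarrow> g x = g y \<Longrightarrow> f x = f y"
    "\<And>x. x \<in> {0..M} \<Longrightarrow> b - N \<le> g x \<Longrightarrow> f x = (if up then g x - (b - N) else b - g x)"
    "b - N \<le> g 0" "b - N \<le> g M"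
  shows "folds N M f p up b g"
  using assms unfolding folds_def by blast

lemma foldsD:
  assumes "folds N M f p up b g"
  shows "continuous_on {0..M} g" "g p = 0" "\<And>x. x \<in> {0..M} \<Longrightarrow> 0 \<le> g x \<and> g x \<le> b" "N \<le> b"
    "\<And>x y. x \<in> {0..M} \<Longrightarrow> y \<in> {0..M} \<Longrightarrow> g x = g y \<Longrightarrow> f x = f y"
    "\<And>x. x \<in> {0..M} \<Longrightarrow> b - N \<le> g x \<Longrightarrow> f x = (if up then g x - (b - N) else b - g x)"
    "b - N \<le> g 0" "b - N \<le> g M"
  using assms unfolding folds_def Ball_def by iprover+

lemma folds_cong:
  assumes "folds N M f p up b g" "\<And>x. x \<in> {0..M} \<Longrightarrow> f x = f' x"
  shows "folds N M f' p up b g"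
proof (rule foldsI)
  show "f' x = f' y" if "x \<in> {0..M}" "y \<in> {0..M}" "g x = g y" for x y
    using foldsD(5)[OF assms(1) that] assms(2) that by simp
  show "f' x = (if up then g x - (b - N) else b - g x)" if "x \<in> {0..M}" "b - N \<le> g x" for x
    using foldsD(6)[OF assms(1) that] assms(2) that by simp
qed (use foldsD(1-4,7,8)[OF assms(1)] in blast)+

text \<open>Reflecting the target exchanges upwards and downwards. Combined with
  \<open>folds_reverse\<close> it reduces an extension at the left end to one at the right
  end.\<close>

lemma folds_reflect:
  assumes "folds N M f p up b g"
  shows "folds N M (\<lambda>x. N - f x) p (\<not> up) b g"
proof (rule foldsI)
  show "N - f x = N - f y" if "x \<in> {0..M}" "y \<in> {0..M}" "g x = g y" for x y
    using foldsD(5)[OF assms(1) that] by simp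
  show "N - f x = (if \<not> up then g x - (b - N) else b - g x)" if "x \<in> {0..M}" "b - N \<le> g x" for x
    using foldsD(6)[OF assms(1) that] by simp
qed (use foldsD(1-4,7,8)[OF assms(1)] in blast)+

lemma folds_reverse:
  assumes "folds N M f p up b g"
  shows "folds N M (\<lambda>x. f (M - x)) (M - p) up b (\<lambda>x. g (M - x))"
proof (rule foldsI)
  show "continuous_on {0..M} (\<lambda>x. g (M - x))"
    by (rule continuous_on_compose2[OF foldsD(1)[OF assms]]) (auto intro!: continuous_intros)
  show "f (M - x) = f (M - y)" if "x \<in> {0..M}" "y \<in> {0..M}" "g (M - x) = g (M - y)" for x y
    by (rule foldsD(5)[OF assms(1)]) (use that in auto)
  show "f (M - x) = (if up then g (M - x) - (b - N) else b - g (M - x))"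
    if "x \<in> {0..M}" "b - N \<le> g (M - x)" for x
    by (rule foldsD(6)[OF assms(1)]) (use that in auto)
  show "0 \<le> g (M - x) \<and> g (M - x) \<le> b" if "x \<in> {0..M}" for x
    by (rule foldsD(3)[OF assms(1)]) (use that in auto)
qed (use foldsD(2,4,7,8)[OF assms] in simp_all)

lemma continuous_on_ivl_if:
  fixes g h :: "real \<Rightarrow> real"
  assumes "continuous_on {u..a} g" "continuous_on {a..v} h" "g a = h a"
  shows "continuous_on {u..v} (\<lambda>x. if x \<le> a then g x else h x)"
proof (rule continuous_on_ivl_glue)
  show "continuous_on {u..a} (\<lambda>x. if x \<le> a then g x else h x)"
    using assms(1) by (rule continuous_on_eq) auto
  show "continuous_on {a..v} (\<lambda>x. if x \<le> a then g x else h x)"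
    using assms(2) by (rule continuous_on_eq) (use assms(3) in auto)
qed

text \<open>An upward last segment is lengthened by \<open>N' - N\<close>, and everything beyond
  \<open>a\<close> is laid onto it according to its value under \<open>f\<close>.\<close>

lemma folds_extend_up:
  assumes g: "folds N a f p True b g" and ap: "p \<le> a" "0 \<le> a" "a \<le> M" and N: "N \<le> N'"
    and f: "continuous_on {a..M} f" "\<And>x. x \<in> {a..M} \<Longrightarrow> 0 \<le> f x \<and> f x \<le> N'"
  shows "folds N' M f p True (b - N + N') (\<lambda>x. if x \<le> a then g x else b - N + f x)"
proof -
  note G = foldsD[OF g, simplified if_True if_False]
  have "f a = g a - (b - N)" using G(6)[of a] G(8) ap by auto
  then have "continuous_on {0..M} (\<lambda>x. if x \<le> a then g x else b - N + f x)"
    using G(1) f(1) by (intro continuous_on_ivl_if continuous_intros) auto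
  moreover have "\<forall>x\<in>{0..M}. \<forall>y\<in>{0..M}. (if x \<le> a then g x else b - N + f x) = (if y \<le> a then g y else b - N + f y) \<longrightarrow> f x = f y"
  proof (intro ballI impI)
    fix x y assume xy: "x \<in> {0..M}" "y \<in> {0..M}"
      and e: "(if x \<le> a then g x else b - N + f x) = (if y \<le> a then g y else b - N + f y)"
    consider "x \<le> a" "y \<le> a" | "x \<le> a" "a < y" | "a < x" "y \<le> a" | "a < x" "a < y" by linarith
    then show "f x = f y"
    proof cases
      case 1
      then show ?thesis using G(5)[of x y] xy e by auto
    next
      case 2
      then show ?thesis using G(6)[of x] f(2)[of y] xy e by auto
    next
      case 3
      then show ?thesis using G(6)[of y] f(2)[of x] xy e by auto
    qed (use e in auto)
  qed
  moreover have "\<forall>x\<in>{0..M}. 0 \<le> (if x \<le> a then g x else b - N + f x) \<and> (if x \<le> a then g x else b - N + f x) \<le> b - N + N'"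
    using G(3,4) f(2) N by fastforce
  moreover have "f x = (if x \<le> a then g x else b - N + f x) - (b - N + N' - N')"
    if "x \<in> {0..M}" "b - N + N' - N' \<le> (if x \<le> a then g x else b - N + f x)" for x
    using that G(6)[of x] by (cases "x \<le> a") simp_all
  ultimately show ?thesis
    using G(2,4,7,8) ap N f(2)[of M] by (intro foldsI) simp_all
qed

lemma folds_extend_down:
  assumes g: "folds N a f p False b g" and ap: "p \<le> a" "0 \<le> a" "a \<le> M"
    and f: "continuous_on {a..M} f" "\<And>x. x \<in> {a..M} \<Longrightarrow> 0 \<le> f x \<and> f x \<le> N"
  shows "folds N M f p False b (\<lambda>x. if x \<le> a then g x else b - N + (N - f x))"
proof -
  have "folds N a (\<lambda>x. N - f x) p True b g" using folds_reflect[OF g] by simp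
  then have "folds N M (\<lambda>x. N - f x) p True (b - N + N) (\<lambda>x. if x \<le> a then g x else b - N + (N - f x))"
    by (rule folds_extend_up) (use ap f in \<open>auto intro!: continuous_intros\<close>)
  from folds_reflect[OF this] show ?thesis by simp
qed

text \<open>Where \<open>f\<close> vanishes, a downward last segment is at its end \<open>b\<close>.
  A new upward segment of length \<open>N'\<close> is attached there, and both ends of the domain
  lie on it.\<close>

lemma folds_turn:
  assumes g: "folds N a f p False b g" and ap: "p \<le> a" "0 \<le> a" "a \<le> M"
    and f: "continuous_on {a..M} f" "\<And>x. x \<in> {a..M} \<Longrightarrow> 0 \<le> f x \<and> f x \<le> N'"
    and f0: "f 0 = 0" "f a = 0" and N: "0 \<le> N"
  shows "folds N' M f p True (b + N') (\<lambda>x. if x \<le> a then g x else b + f x)"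
proof -
  note G = foldsD[OF g, simplified if_True if_False]
  \<comment> \<open>Both ends lie on the downward segment, whose only zero is at
    \<open>b\<close>.\<close>
  have ga: "g a = b" "g 0 = b" using G(6)[of a] G(6)[of 0] G(7,8) ap f0 by auto
  have b: "x \<in> {0..a} \<Longrightarrow> b \<le> g x \<Longrightarrow> g x = b \<and> f x = 0" for x using G(3)[of x] G(6)[of x] N by force
  have "0 \<le> N'" using f(2)[of a] ap by auto
  have "continuous_on {0..M} (\<lambda>x. if x \<le> a then g x else b + f x)"
    using G(1) f(1) ga f0 by (intro continuous_on_ivl_if continuous_intros) auto
  moreover have "\<forall>x\<in>{0..M}. \<forall>y\<in>{0..M}. (if x \<le> a then g x else b + f x) = (if y \<le> a then g y else b + f y) \<longrightarrow> f x = f y"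
  proof (intro ballI impI)
    fix x y assume xy: "x \<in> {0..M}" "y \<in> {0..M}"
      and e: "(if x \<le> a then g x else b + f x) = (if y \<le> a then g y else b + f y)"
    consider "x \<le> a" "y \<le> a" | "x \<le> a" "a < y" | "a < x" "y \<le> a" | "a < x" "a < y" by linarith
    then show "f x = f y"
    proof cases
      case 1
      then show ?thesis using G(5)[of x y] xy e by auto
    next
      case 2
      then show ?thesis using b[of x] f(2)[of y] xy e by auto
    next
      case 3
      then show ?thesis using b[of y] f(2)[of x] xy e by auto
    qed (use e in auto)
  qed
  moreover have "\<forall>x\<in>{0..M}. 0 \<le> (if x \<le> a then g x else b + f x) \<and> (if x \<le> a then g x else b + f x) \<le> b + N'"
    using G(3,4) f(2) N \<open>0 \<le> N'\<close> by fastforce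
  moreover have "f x = (if x \<le> a then g x else b + f x) - (b + N' - N')"
    if "x \<in> {0..M}" "b + N' - N' \<le> (if x \<le> a then g x else b + f x)" for x
    using that b[of x] by (cases "x \<le> a") simp_all
  ultimately show ?thesis
    using G(2,4,7,8) ap N f(2)[of M] ga by (intro foldsI) simp_all
qed

text \<open>An upward segment is lengthened. A downward one is followed as far as \<open>a'\<close>,
  where \<open>f\<close> is 0, and turned. This is why a prolonged edge first runs back to the far
  end of its child.\<close>

lemma folds_extend:
  assumes g: "folds N a f p up b g" and ap: "p \<le> a" "0 \<le> a" "a \<le> a'" "a' \<le> M" and N: "0 \<le> N" "N \<le> N'"
    and f: "continuous_on {a..M} f" "\<And>x. x \<in> {a..M} \<Longrightarrow> 0 \<le> f x \<and> f x \<le> N'"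
      "\<And>x. x \<in> {a..a'} \<Longrightarrow> f x \<le> N"
    and f0: "f 0 = 0" "f a' = 0"
  shows "\<exists>b g. folds N' M f p True b g"
proof (cases up)
  case True
  then show ?thesis using folds_extend_up[of N a f p b g M N'] g ap N f by auto
next
  case False
  have "folds N a' f p False b (\<lambda>x. if x \<le> a then g x else b - N + (N - f x))"
  proof (rule folds_extend_down)
    show "continuous_on {a..a'} f" by (rule continuous_on_subset[OF f(1)]) (use ap in auto)
  qed (use False g ap f in auto)
  then have "folds N' M f p True (b + N')
      (\<lambda>x. if x \<le> a' then (if x \<le> a then g x else b - N + (N - f x)) else b + f x)"
  proof (rule folds_turn)
    show "continuous_on {a'..M} f" by (rule continuous_on_subset[OF f(1)]) (use ap in auto)
  qed (use ap f f0 N in auto)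
  then show ?thesis by blast
qed

context splitting
begin

lemma bond_node_middle:
  assumes v: "valid (Node l k r)" and a: "a = len (step l)" and n: "n = len (Node l k r)"
    and x: "a \<le> x" "x \<le> a + end_value l + n + len r"
  shows "bond (Node l k r) x = min \<bar>x - a - end_value l\<bar> (2 * n - \<bar>x - a - end_value l\<bar>)"
proof -
  have bd: "0 \<le> len (step l)" "0 \<le> len (step r)" "0 \<le> end_value l" "end_value l \<le> len l" "0 \<le> len l" "0 \<le> len r" "k > 0"
    using v len_step_pos end_value_bounds len_nonneg by auto
  have n': "n = len l + k + len r" using n by simp
  consider "x = a" | "a < x" "x < a + end_value l + n + len r" | "x \<noteq> a" "x = a + end_value l + n + len r"
    using x by linarith
  then show ?thesis
  proof cases
    case 1
    then have "bond (Node l k r) x = end_value l" using bond_end v by (auto simp: Let_def a)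
    then show ?thesis using 1 bd by (auto simp: n')
  next
    case 2
    then show ?thesis by (auto simp: Let_def a n')
  next
    case 3
    then have "bond (Node l k r) x = len l + k"
      using bond_zero v x by (auto simp: Let_def a n')
    then show ?thesis using 3 bd by (auto simp: n')
  qed
qed

lemma folds_leaf_block:
  "occurs t p u q \<Longrightarrow> u = Leaf s \<Longrightarrow> valid t \<Longrightarrow> q \<le> x \<Longrightarrow> x \<le> q + len (step u) \<Longrightarrow>
   \<exists>up b g. folds (len t) (len (step t)) (bond t) x up b g"
proof (induction arbitrary: x rule: occurs.induct)
  case (refl t)
  then have "folds (len t) (len (step t)) (bond t) x True 0 (\<lambda>x. 0)"
    by (auto simp: folds_def)
  then show ?case by blast
next
  case (left l p u q k r)
  define a n M where "a = len (step l)" and "n = len (Node l k r)" and "M = len (step (Node l k r))"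
  have bd: "0 \<le> len (step l)" "0 \<le> len (step r)" "0 \<le> end_value l" "end_value l \<le> len l" "0 \<le> len l" "0 \<le> len r" "k > 0"
    using left len_step_pos end_value_bounds len_nonneg by auto
  have "valid l" using left.prems(2) by simp
  then obtain up b g where g: "folds (len l) a (bond l) x up b g"
    using left.IH[OF left.prems(1) _ left.prems(3,4)] unfolding a_def by blast
  have g': "folds (len l) a (bond (Node l k r)) x up b g"
    by (rule folds_cong[OF g]) (auto simp: Let_def a_def)
  have x: "x \<le> a" using left.prems(4) occurs_bounds[OF left(1) \<open>valid l\<close>] unfolding a_def by linarith
  have "\<exists>b g. folds n M (bond (Node l k r)) x True b g"
  proof (rule folds_extend[OF g' x])
    show "continuous_on {a..M} (bond (Node l k r))"
      by (rule continuous_on_subset[OF continuous_on_bond[OF left.prems(2)]]) (use bd in \<open>auto simp: a_def M_def\<close>)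
    show "0 \<le> bond (Node l k r) y \<and> bond (Node l k r) y \<le> n" if "y \<in> {a..M}" for y
      unfolding n_def by (rule bond_range) (use that bd left in \<open>auto simp: a_def M_def\<close>)
    show "bond (Node l k r) y \<le> len l" if "y \<in> {a..a + end_value l}" for y
      using bond_node_middle[OF left.prems(2) a_def n_def, of y] that bd by (auto simp: n_def)
    show "bond (Node l k r) 0 = 0" using bond_zero left.prems(2) by blast
    show "bond (Node l k r) (a + end_value l) = 0"
      using bond_node_ascent[OF left.prems(2), of 0] bd by (auto simp: a_def simp del: bond.simps)
  qed (use bd in \<open>auto simp: a_def n_def M_def\<close>)
  then show ?case unfolding n_def M_def by blast
next
  case (right r p u q l k)
  define a n M B c where "a = len (step l)" and "n = len (Node l k r)" and "M = len (step (Node l k r))"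
    and "B = len (step l) + (end_value l + len (Node l k r) + len r)" and "c = len (step r)"
  have bd: "0 \<le> a" "0 \<le> c" "0 \<le> end_value l" "end_value l \<le> len l" "0 \<le> len l" "0 \<le> len r" "k > 0" "n = len l + k + len r"
    using right len_step_pos end_value_bounds len_nonneg by (auto simp: a_def n_def c_def)
  have B: "B = a + end_value l + n + len r" "M = B + c" "0 \<le> B" using bd by (auto simp: a_def B_def M_def n_def c_def)
  \<comment> \<open>The bonding map with domain and target reversed: the right child now comes
    first, and the turn at \<open>c + len r\<close> is the point where the original map reaches
    \<open>n\<close>.\<close>
  define f where "f = (\<lambda>y. n - bond (Node l k r) (M - y))"
  have "valid r" using right.prems(2) by simp
  moreover have "q \<le> x - B" "x - B \<le> q + len (step u)" using right.prems(3,4) unfolding B_def by linarith+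
  ultimately obtain up b g where g: "folds (len r) c (bond r) (x - B) up b g"
    using right.IH[OF right.prems(1), of "x - B"] unfolding c_def by blast
  have xB: "x \<ge> B" using \<open>q \<le> x - B\<close> occurs_bounds[OF right(1) \<open>valid r\<close>] by linarith
  have "folds (len r) c f (c - (x - B)) (\<not> up) b (\<lambda>y. g (c - y))"
  proof (rule folds_cong[OF folds_reflect[OF folds_reverse[OF g]]])
    fix y assume "y \<in> {0..c}"
    then have "bond (Node l k r) (B + (c - y)) = len l + k + bond r (c - y)"
      unfolding B_def using bond_node_right right.prems(2) by auto
    moreover have "M - y = B + (c - y)" using B(2) by simp
    ultimately have "f y = n - (len l + k + bond r (c - y))" by (simp only: f_def)
    then show "len r - bond r (c - y) = f y" using bd(8) by linarith
  qed
  then have "\<exists>b g. folds n M f (c - (x - B)) True b g"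
  proof (rule folds_extend)
    have "continuous_on {c..M} (\<lambda>y. bond (Node l k r) (M - y))"
      by (rule continuous_on_compose2[OF continuous_on_bond[OF right.prems(2), folded M_def]])
        (use bd in \<open>auto intro!: continuous_intros\<close>)
    then show "continuous_on {c..M} f" unfolding f_def by (intro continuous_intros)
    show "0 \<le> f y \<and> f y \<le> n" if "y \<in> {c..M}" for y
      using bond_range[OF right.prems(2), of "M - y"] that bd(2) unfolding M_def[symmetric] n_def[symmetric] f_def by auto
    show "f y \<le> len r" if "y \<in> {c..c + len r}" for y
    proof -
      have "bond (Node l k r) (M - y) = min \<bar>M - y - a - end_value l\<bar> (2 * n - \<bar>M - y - a - end_value l\<bar>)"
        by (rule bond_node_middle[OF right.prems(2) a_def n_def]) (use that bd B in auto)
      moreover have "n - len r \<le> M - y - a - end_value l" "M - y - a - end_value l \<le> n + len r"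
        using that bd B by auto
      moreover have "0 \<le> n - len r" using bd by simp
      ultimately show ?thesis unfolding f_def by (simp add: min_def del: bond.simps split: if_splits)
    qed
    show "f 0 = 0" using bond_end[OF right.prems(2)] end_value_not_pend[OF right.prems(2)] by (simp add: f_def M_def n_def del: bond.simps)
    have "bond (Node l k r) (a + end_value l + n) = n"
      using bond_node_ascent[OF right.prems(2), of n] bd by (auto simp: a_def n_def simp del: bond.simps)
    moreover have "M - (c + len r) = a + end_value l + n" using B by simp
    ultimately show "f (c + len r) = 0" by (simp add: f_def del: bond.simps)
  qed (use bd B xB in \<open>auto simp: n_def\<close>)
  then obtain b g where fo: "folds n M f (c - (x - B)) True b g" by blast
  have "folds n M (bond (Node l k r)) (M - (c - (x - B))) (\<not> True) b (\<lambda>y. g (M - y))"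
    by (rule folds_cong[OF folds_reflect[OF folds_reverse[OF fo]]]) (simp add: f_def del: bond.simps)
  moreover have "M - (c - (x - B)) = x" using B by simp
  ultimately have "folds n M (bond (Node l k r)) x (\<not> True) b (\<lambda>y. g (M - y))" by (simp only:)
  then show ?case unfolding n_def[symmetric] M_def[symmetric] by blast
next
  case (pend t p u q c s j)
  obtain l k r where t: "t = Node l k r" "len l < c" "c < len l + k" "valid t" "valid l" "valid r" "k > 0" "\<not> is_pend t"
    using pend.prems by auto
  define M where "M = len (step t)"
  have bd: "0 \<le> len l" "0 \<le> len r" "0 \<le> M"
    using t(5,6) len_nonneg len_step_pos[OF t(4)] by (auto simp: M_def)
  then have c: "0 < c" "c \<le> len t" using t(1-3,7) by auto
  obtain up b g where g: "folds (len t) M (bond t) x up b g"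
    using pend.IH[OF pend.prems(1) t(4) pend.prems(3,4)] unfolding M_def by blast
  let ?f = "bond (Pend t c s j)"
  have g': "folds (len t) M ?f x up b g"
    by (rule folds_cong[OF g]) (auto simp: Let_def M_def)
  have x: "x \<le> M" using pend.prems(4) occurs_bounds[OF pend(1) t(4)] unfolding M_def by linarith
  show ?case
  proof (cases "P (j # s) = {}")
    case True
    then have "len (step (Pend t c s j)) = M" by (simp add: Let_def M_def)
    then show ?thesis using g' by (auto simp del: bond.simps)
  next
    case False
    then have M: "len (step (Pend t c s j)) = M + len t + c" by (simp add: Let_def M_def)
    have co: "continuous_on {M..M + len t + c} ?f"
      by (rule continuous_on_subset[OF continuous_on_bond[OF pend.prems(2)]]) (use bd M in auto)
    have ra: "0 \<le> ?f y \<and> ?f y \<le> len t" if "y \<in> {M..M + len t + c}" for y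
      using bond_range[OF pend.prems(2), of y] that bd M by auto
    show ?thesis
    proof (cases up)
      case True
      have "\<exists>b g. folds (len t) (M + len t + c) ?f x True b g"
        using folds_extend_up[of "len t" M ?f x b g "M + len t + c" "len t"] g' True x bd c co ra by fastforce
      then show ?thesis unfolding M by (auto simp del: bond.simps)
    next
      case False
      have "\<exists>b g. folds (len t) (M + len t + c) ?f x False b g"
        using folds_extend_down[of "len t" M ?f x b g "M + len t + c"] g' False x bd c co ra by fastforce
      then show ?thesis unfolding M by (auto simp del: bond.simps)
    qed
  qed
qed

end

subsection \<open>The limit space\<close>

context splitting
begin

definition approx :: "nat \<Rightarrow> tree" where
  "approx n = (step ^^ n) (Leaf [])"

definition limit_space :: "(nat \<Rightarrow> real) set" where
  "limit_space = inverse_limit (\<lambda>n. bond (approx n)) (\<lambda>n. {0..len (approx n)})"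

definition thread :: "'a \<Rightarrow> nat \<Rightarrow> real" where
  "thread x n = place (approx n) x"

lemma approx_0: "approx 0 = Leaf []" and approx_Suc: "approx (Suc n) = step (approx n)"
  by (simp_all add: approx_def)

lemma valid_approx: "valid (approx n)"
  by (induction n) (simp_all add: approx_0 approx_Suc valid_step)

lemma separated_approx: "separated (approx n)"
  by (induction n) (simp_all add: approx_0 approx_Suc separated_step)

lemma content_approx: "content (approx n) = P []"
  by (induction n) (simp_all add: approx_0 approx_Suc content_step)

lemma limit_spaceD:
  assumes "x \<in> limit_space"
  shows "0 \<le> x n" "x n \<le> len (approx n)" "bond (approx n) (x (Suc n)) = x n"
proof -
  have "\<forall>n. x n \<in> {0..len (approx n)} \<and> x n = bond (approx n) (x (Suc n))"
    using assms unfolding limit_space_def inverse_limit_def by (rule CollectD)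
  from this[THEN spec, of n] show "0 \<le> x n" "x n \<le> len (approx n)" "bond (approx n) (x (Suc n)) = x n"
    by simp_all
qed

lemma limit_space_continuum: "compact limit_space" "connected limit_space" "limit_space \<noteq> {}"
proof -
  have 1: "0 \<le> len (approx n)" for n using len_nonneg valid_approx by blast
  have 2: "continuous_on {0..len (approx (Suc n))} (bond (approx n))" for n
    using continuous_on_bond[OF valid_approx] by (simp add: approx_Suc)
  have 3: "bond (approx n) x \<in> {0..len (approx n)}" if "x \<in> {0..len (approx (Suc n))}" for n x
    using bond_range[OF valid_approx] that by (simp add: approx_Suc)
  show "compact limit_space" "connected limit_space" "limit_space \<noteq> {}"
    unfolding limit_space_def 
    using inverse_limit_continuum[where \<alpha> = "\<lambda>_. 0" and \<beta> = "\<lambda>n. len (approx n)" and f = "\<lambda>n. bond (approx n)", OF 1 2 3]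
    by blast+
qed

lemma agree_below:
  assumes "x \<in> limit_space" "y \<in> limit_space" "x m = y m" "n \<le> m"
  shows "x n = y n"
  using assms(4,3)
proof (induction rule: dec_induct)
  case (step i)
  have "x i = y i" if "x (Suc i) = y (Suc i)"
    using that limit_spaceD(3)[OF assms(1), of i] limit_spaceD(3)[OF assms(2), of i] by simp
  then show ?case using step by blast
qed

lemma thread_mem: "x \<in> P [] \<Longrightarrow> thread x \<in> limit_space"
  using place_bounds[OF valid_approx, of _ x] bond_place_step[OF valid_approx, of x] content_approx
  by (auto simp: limit_space_def inverse_limit_def thread_def approx_Suc)

lemma length_lab_le: "x \<in> P [] \<Longrightarrow> length (label_at (approx n) x) \<le> n"
proof (induction n)
  case (Suc n)
  have "x \<in> content (approx n)" using Suc content_approx by simp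
  then show ?case
    using delay_Suc[of x "approx n"] delay_0[of x "approx n"] Suc by (cases "delay (approx n) x") (auto simp: approx_Suc)
qed (simp add: approx_0)

text \<open>The stage is late enough to control the metric of the limit, and the address long enough
  to make the part small.\<close>

lemma thread_at_leaf:
  assumes x: "x \<in> P []"
  shows "\<exists>n s q. N \<le> n \<and> N \<le> length s \<and> x \<in> P s \<and> occurs (approx n) (thread x n) (Leaf s) q \<and>
    q \<le> thread x (Suc n) \<and> thread x (Suc n) \<le> q + len (step (Leaf s))"
proof -
  have "x \<in> content (Leaf [])" using x by simp
  from label_at_unbounded[OF this, of N] obtain n where n: "delay (approx n) x = 0" "N \<le> length (label_at (approx n) x)"
    unfolding approx_def by blast
  define s where "s = label_at (approx n) x"
  have xc: "x \<in> content (approx n)" using x content_approx by simp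
  then have xs: "x \<in> P s" unfolding s_def by (rule label_at_mem)
  obtain q where q: "occurs (approx n) (thread x n) (Leaf s) q"
    using delay_0_occurs[OF xc n(1)] unfolding s_def thread_def by blast
  have "thread x (Suc n) = q + place (step (Leaf s)) x"
    using place_occurs[OF q separated_approx] xs by (simp add: thread_def approx_Suc del: step.simps)
  moreover have "0 \<le> place (step (Leaf s)) x" "place (step (Leaf s)) x \<le> len (step (Leaf s))"
    using place_bounds[of "step (Leaf s)" x] valid_step[of "Leaf s"] by (simp_all del: step.simps)
  moreover have "N \<le> n" using n(2) length_lab_le[OF x, of n] by simp
  ultimately show ?thesis using n(2) xs q unfolding s_def[symmetric] by (intro exI[of _ n] exI[of _ s] exI[of _ q]) simp
qed

text \<open>The factor \<open>g\<close> of the bonding map at stage \<open>n\<close> begins at the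
  thread. Points of the limit with equal \<open>g\<close>-value at stage \<open>Suc n\<close> agree
  at stage \<open>n\<close> and before, hence are close.\<close>

lemma thread_end_point:
  assumes x: "x \<in> P []"
  shows "thread x \<in> end_points (metric_on limit_space)"
proof -
  have "\<exists>n U. chain_cover (metric_on limit_space) \<epsilon> n U \<and> thread x \<in> U 1" if eps: "\<epsilon> > 0" for \<epsilon>
  proof -
    obtain N where N: "\<And>y z :: nat \<Rightarrow> real. (\<forall>n\<le>N. y n = z n) \<Longrightarrow> dist y z < \<epsilon> / 2"
      using dist_fun_less_if_initial_agree[OF half_gt_zero[OF eps]] by blast
    obtain n s q where n: "N \<le> n" "occurs (approx n) (thread x n) (Leaf s) q"
      "q \<le> thread x (Suc n)" "thread x (Suc n) \<le> q + len (step (Leaf s))"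
      using thread_at_leaf[OF x, of N] by blast
    obtain up b g where g: "folds (len (approx n)) (len (step (approx n))) (bond (approx n)) (thread x (Suc n)) up b g"
      using folds_leaf_block[OF n(2) HOL.refl valid_approx n(3,4)] by blast
    have rng: "z (Suc n) \<in> {0..len (step (approx n))}" if "z \<in> limit_space" for z
      using limit_spaceD(1,2)[OF that, of "Suc n"] by (simp add: approx_Suc)
    show ?thesis
    proof (rule chain_cover_from_map)
      show "continuous_on limit_space (\<lambda>z. g (z (Suc n)))"
      proof (rule continuous_on_compose2[OF foldsD(1)[OF g]])
        show "continuous_on limit_space (\<lambda>z. z (Suc n))"
          by (rule continuous_on_subset[OF continuous_on_product_coordinates]) simp
      qed (use rng in blast)
      show "g (thread x (Suc n)) = 0" by (rule foldsD(2)[OF g])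
      show "0 \<le> g (z (Suc n))" if "z \<in> limit_space" for z using foldsD(3)[OF g rng[OF that]] by blast
      show "dist y z < \<epsilon> / 2" if "y \<in> limit_space" "z \<in> limit_space" "g (y (Suc n)) = g (z (Suc n))" for y z
      proof (rule N)
        have "y n = z n"
          using foldsD(5)[OF g rng[OF that(1)] rng[OF that(2)] that(3)] limit_spaceD(3)[OF that(1)] limit_spaceD(3)[OF that(2)]
          by simp
        then show "\<forall>i\<le>N. y i = z i" using agree_below[OF that(1,2)] n(1) by auto
      qed
    qed (use limit_space_continuum thread_mem[OF x] \<open>\<epsilon> > 0\<close> in auto)
  qed
  then show ?thesis using thread_mem[OF x] by (auto simp: end_points_def)
qed

lemma chainable_limit_space: "chainable (metric_on limit_space)"
proof -
  obtain x where "x \<in> P []" using P_root by blast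
  from thread_end_point[OF this] show ?thesis
    using limit_space_continuum by (auto simp: chainable_def end_points_def metric_continuum_metric_on)
qed

text \<open>From stage \<open>m\<close> on, all points of \<open>C\<close> lie in the evolution of the subtree \<open>u m\<close>.\<close>

definition block :: "nat \<Rightarrow> (nat \<Rightarrow> real) \<Rightarrow> (nat \<Rightarrow> tree) \<Rightarrow> (nat \<Rightarrow> real) set \<Rightarrow> bool" where
  "block m p u C \<longleftrightarrow> (\<forall>n\<ge>m. occurs (approx n) (p n) (u n) (p (Suc n)) \<and> u (Suc n) = step (u n)) \<and>
     (\<forall>c\<in>C. \<forall>n\<ge>m. p n \<le> c n \<and> c n \<le> p n + len (u n))"

definition at_leaf :: "(nat \<Rightarrow> real) set \<Rightarrow> nat \<Rightarrow> nat list \<Rightarrow> bool" where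
  "at_leaf C m s \<longleftrightarrow> P s \<noteq> {} \<and> (\<exists>p u. block m p u C \<and> u m = Leaf s)"

text \<open>One point strictly inside the edge at one stage is enough; by \<open>edge_later\<close>
  it remains inside.\<close>

definition on_edge :: "(nat \<Rightarrow> real) set \<Rightarrow> nat \<Rightarrow> (nat \<Rightarrow> real) \<Rightarrow> (nat \<Rightarrow> tree) \<Rightarrow> (nat \<Rightarrow> real) \<Rightarrow> (nat \<Rightarrow> tree) \<Rightarrow> bool" where
  "on_edge C m p l k r \<longleftrightarrow> block m p (\<lambda>n. Node (l n) (k n) (r n)) C \<and>
     (\<exists>c\<in>C. p m + len (l m) < c m \<and> c m < p m + len (l m) + k m)"

lemma blockD:
  assumes "block m p u C" "m \<le> n"
  shows "occurs (approx n) (p n) (u n) (p (Suc n))" "u (Suc n) = step (u n)"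
    "c \<in> C \<Longrightarrow> p n \<le> c n" "c \<in> C \<Longrightarrow> c n \<le> p n + len (u n)"
    "valid (u n)" "C \<subseteq> limit_space \<Longrightarrow> c \<in> C \<Longrightarrow> c n = p n + bond (u n) (c (Suc n) - p (Suc n))"
proof -
  have *: "\<And>n. m \<le> n \<Longrightarrow> occurs (approx n) (p n) (u n) (p (Suc n)) \<and> u (Suc n) = step (u n)"
    "\<And>n c. c \<in> C \<Longrightarrow> m \<le> n \<Longrightarrow> p n \<le> c n \<and> c n \<le> p n + len (u n)"
    using assms(1) unfolding block_def by blast+
  show 1: "occurs (approx n) (p n) (u n) (p (Suc n))" "u (Suc n) = step (u n)"
    "c \<in> C \<Longrightarrow> p n \<le> c n" "c \<in> C \<Longrightarrow> c n \<le> p n + len (u n)"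
    using *(1)[OF assms(2)] *(2)[OF _ assms(2)] by blast+
  show "valid (u n)" using occurs_valid[OF 1(1) valid_approx] .
  show "c n = p n + bond (u n) (c (Suc n) - p (Suc n))" if "C \<subseteq> limit_space" "c \<in> C"
  proof -
    have "p (Suc n) \<le> c (Suc n) \<and> c (Suc n) \<le> p (Suc n) + len (step (u n))"
      using *(2)[OF that(2), of "Suc n"] assms(2) 1(2) by simp
    then have "bond (approx n) (p (Suc n) + (c (Suc n) - p (Suc n))) = p n + bond (u n) (c (Suc n) - p (Suc n))"
      by (intro bond_occurs[OF 1(1) valid_approx]) auto
    then show ?thesis using limit_spaceD(3)[of c n] that by auto
  qed
qed

lemma block_later: "block m p u C \<Longrightarrow> m \<le> n \<Longrightarrow> block n p u C"
  unfolding block_def by (meson le_trans)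

lemma block_nodes:
  assumes "block m p u C" "u m = Node l k r"
  shows "\<exists>l k r. block m p (\<lambda>n. Node (l n) (k n) (r n)) C \<and> (\<forall>n\<ge>m. u n = Node (l n) (k n) (r n))"
proof -
  have "\<exists>l k r. u n = Node l k r" if "m \<le> n" for n
    using that
  proof (induction rule: dec_induct)
    case base
    then show ?case using assms(2) by blast
  next
    case (step n)
    then show ?case using blockD(2)[OF assms(1) step(1)] by auto
  qed
  then obtain l k r where *: "\<And>n. m \<le> n \<Longrightarrow> u n = Node (l n) (k n) (r n)" by metis
  then have "block m p (\<lambda>n. Node (l n) (k n) (r n)) C"
    using assms(1) unfolding block_def by (simp del: step.simps len.simps)
  then show ?thesis using * by blast
qed

text \<open>By \<open>bond_node_inv\<close> the next coordinate lies on the ascending run, which is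
  again inside the prolonged edge, so the argument repeats.\<close>

lemma edge_later:
  assumes b: "block m p (\<lambda>n. Node (l n) (k n) (r n)) C" and C: "C \<subseteq> limit_space" "c \<in> C"
    and n: "m \<le> n" and e: "p n + len (l n) < c n" "c n < p n + len (l n) + k n" and i: "n \<le> i"
  shows "p i + len (l i) < c i \<and> c i < p i + len (l i) + k i \<and> c (Suc i) = edge_lift (approx i) (c i) \<and>
    c (Suc i) = p (Suc i) + (len (step (l i)) + end_value (l i) + (c i - p i))"
proof -
  have next_pos: "c (Suc i) = p (Suc i) + (len (step (l i)) + end_value (l i) + (c i - p i))"
    if "m \<le> i" "p i + len (l i) < c i" "c i < p i + len (l i) + k i" for i
  proof -
    have bond: "c i - p i = bond (Node (l i) (k i) (r i)) (c (Suc i) - p (Suc i))"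
      using blockD(6)[OF b \<open>m \<le> i\<close> C] by (simp del: bond.simps)
    have le: "p (Suc i) \<le> c (Suc i)" "c (Suc i) \<le> p (Suc i) + len (step (Node (l i) (k i) (r i)))"
      using blockD(3,4)[OF b le_SucI[OF \<open>m \<le> i\<close>] C(2)] blockD(2)[OF b \<open>m \<le> i\<close>] by simp_all
    have "c (Suc i) - p (Suc i) = len (step (l i)) + end_value (l i) + bond (Node (l i) (k i) (r i)) (c (Suc i) - p (Suc i))"
      by (rule bond_node_inv[OF blockD(5)[OF b \<open>m \<le> i\<close>]]) (use le that bond[symmetric] in \<open>simp_all del: bond.simps len.simps step.simps\<close>)
    then show ?thesis using bond by simp
  qed
  have edge: "p i + len (l i) < c i \<and> c i < p i + len (l i) + k i"
    using i
  proof (induction rule: dec_induct)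
    case base
    then show ?case using e by blast
  next
    case (step i)
    then have mi: "m \<le> i" using n by simp
    have v: "valid (Node (l i) (k i) (r i))" using blockD(5)[OF b mi] .
    then have "0 \<le> end_value (l i)" "0 \<le> len (l i)" "0 \<le> len (r i)" using end_value_bounds len_nonneg by auto
    moreover have "l (Suc i) = step (l i)" "k (Suc i) = end_value (l i) + len (Node (l i) (k i) (r i)) + len (r i)"
      using blockD(2)[OF b mi] by simp_all
    ultimately show ?case using next_pos[OF mi] step by simp
  qed
  have mi: "m \<le> i" using n i by simp
  have "edge_lift (approx i) (p i + (c i - p i)) = p (Suc i) + (len (step (l i)) + end_value (l i) + (c i - p i))"
    by (rule edge_lift_occurs[OF blockD(1)[OF b mi] HOL.refl valid_approx]) (use edge in auto)
  then show ?thesis using edge next_pos[OF mi] by simp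
qed

text \<open>A connected set that avoids the edge lies on one side of it at each stage.\<close>

lemma node_split:
  assumes b: "block m p u C" and u: "u m = Node l0 k0 r0"
    and C: "C \<subseteq> limit_space" "connected C" "C \<noteq> {}" and no: "\<nexists>m p l k r. on_edge C m p l k r"
  shows "(\<exists>u. block m p u C \<and> u m = l0) \<or> (\<exists>p u. block m p u C \<and> u m = r0)"
proof -
  obtain l k r where b: "block m p (\<lambda>n. Node (l n) (k n) (r n)) C"
    and "\<forall>n\<ge>m. u n = Node (l n) (k n) (r n)" using block_nodes[OF b u] by blast
  then have m0: "l m = l0" "r m = r0" using u by auto
  \<comment> \<open>A set with points on both sides would contain a point over the middle of the
    edge.\<close>
  have sides: "(\<forall>c\<in>C. c n \<le> p n + len (l n)) \<or> (\<forall>c\<in>C. p n + len (l n) + k n \<le> c n)" if "m \<le> n" for n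
  proof (rule ccontr)
    have ne: "\<not> (p n + len (l n) < c n \<and> c n < p n + len (l n) + k n)" if "c \<in> C" for c
      using no block_later[OF b \<open>m \<le> n\<close>] that unfolding on_edge_def by blast
    assume "\<not> ?thesis"
    then obtain c c' where c: "c \<in> C" "c' \<in> C" "p n + len (l n) < c n" "c' n < p n + len (l n) + k n"
      by (auto simp: not_le)
    then have "p n + len (l n) + k n \<le> c n" "c' n \<le> p n + len (l n)" using ne by force+
    moreover have k: "0 < k n" using blockD(5)[OF b that] by simp
    moreover have "connected ((\<lambda>c. c n) ` C)"
      by (rule connected_continuous_image[OF continuous_on_subset[OF continuous_on_product_coordinates] C(2)]) simp
    ultimately have "p n + len (l n) + k n / 2 \<in> (\<lambda>c. c n) ` C"
      using connectedD_interval[of "(\<lambda>c. c n) ` C" "c' n" "c n" "p n + len (l n) + k n / 2"] c by auto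
    then obtain d where "d \<in> C" "d n = p n + len (l n) + k n / 2" by auto
    then show False using ne[of d] k by simp
  qed
  \<comment> \<open>The bonding map sends either child into itself, so a change of side at the next
    stage would be visible at the present one.\<close>
  have persist: "((\<forall>c\<in>C. c n \<le> p n + len (l n)) \<longrightarrow> (\<forall>c\<in>C. c (Suc n) \<le> p (Suc n) + len (l (Suc n)))) \<and>
      ((\<forall>c\<in>C. p n + len (l n) + k n \<le> c n) \<longrightarrow> (\<forall>c\<in>C. p (Suc n) + len (l (Suc n)) + k (Suc n) \<le> c (Suc n)))"
    if n: "m \<le> n" for n
  proof -
    have v: "valid (Node (l n) (k n) (r n))" using blockD(5)[OF b n] .
    then have bd: "0 < k n" "valid (l n)" "valid (r n)" by simp_all
    have eq: "l (Suc n) = step (l n)" "k (Suc n) = end_value (l n) + len (Node (l n) (k n) (r n)) + len (r n)" "r (Suc n) = step (r n)"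
      using blockD(2)[OF b n] by simp_all
    have Fc: "c n = p n + bond (Node (l n) (k n) (r n)) (c (Suc n) - p (Suc n))"
      "p (Suc n) \<le> c (Suc n)" "c (Suc n) \<le> p (Suc n) + len (Node (l (Suc n)) (k (Suc n)) (r (Suc n)))" if "c \<in> C" for c
      using blockD(6)[OF b n C(1) that] blockD(3,4)[OF b le_SucI[OF n] that] by blast+
    have L: "c n \<le> p n + len (l n)" if "c \<in> C" "c (Suc n) \<le> p (Suc n) + len (l (Suc n))" for c
    proof -
      have "bond (Node (l n) (k n) (r n)) (c (Suc n) - p (Suc n)) = bond (l n) (c (Suc n) - p (Suc n))"
        using that eq by (simp add: Let_def)
      moreover have "bond (l n) (c (Suc n) - p (Suc n)) \<le> len (l n)"
        using bond_range[OF bd(2), of "c (Suc n) - p (Suc n)"] Fc[OF that(1)] that(2) eq by auto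
      ultimately show ?thesis using Fc(1)[OF that(1)] by linarith
    qed
    have R: "p n + len (l n) + k n \<le> c n" if "c \<in> C" "p (Suc n) + len (l (Suc n)) + k (Suc n) \<le> c (Suc n)" for c
    proof -
      define y where "y = c (Suc n) - p (Suc n) - (len (step (l n)) + (end_value (l n) + len (Node (l n) (k n) (r n)) + len (r n)))"
      have y: "0 \<le> y" "y \<le> len (step (r n))" using that(2) eq Fc(3)[OF that(1)] unfolding y_def by auto
      have "c (Suc n) - p (Suc n) = len (step (l n)) + (end_value (l n) + len (Node (l n) (k n) (r n)) + len (r n)) + y"
        unfolding y_def by simp
      then have "bond (Node (l n) (k n) (r n)) (c (Suc n) - p (Suc n)) = len (l n) + k n + bond (r n) y"
        using bond_node_right[OF v y(1)] by (simp only:)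
      moreover have "0 \<le> bond (r n) y" using bond_range[OF bd(3) y] by blast
      ultimately show ?thesis using Fc(1)[OF that(1)] by linarith
    qed
    obtain c0 where c0: "c0 \<in> C" using C by blast
    have "m \<le> Suc n" using n by simp
    note sides' = sides[OF this]
    show ?thesis
    proof (intro conjI impI)
      assume "\<forall>c\<in>C. c n \<le> p n + len (l n)"
      then have "\<not> p n + len (l n) + k n \<le> c0 n" using c0 bd(1) by force
      then have "\<not> p (Suc n) + len (l (Suc n)) + k (Suc n) \<le> c0 (Suc n)" using R[OF c0] by blast
      then show "\<forall>c\<in>C. c (Suc n) \<le> p (Suc n) + len (l (Suc n))" using sides' c0 by blast
    next
      assume "\<forall>c\<in>C. p n + len (l n) + k n \<le> c n"
      then have "\<not> c0 n \<le> p n + len (l n)" using c0 bd(1) by force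
      then have "\<not> c0 (Suc n) \<le> p (Suc n) + len (l (Suc n))" using L[OF c0] by blast
      then show "\<forall>c\<in>C. p (Suc n) + len (l (Suc n)) + k (Suc n) \<le> c (Suc n)" using sides' c0 by blast
    qed
  qed
  show ?thesis
    using sides[OF order_refl]
  proof
    assume start: "\<forall>c\<in>C. c m \<le> p m + len (l m)"
    have "\<forall>c\<in>C. c n \<le> p n + len (l n)" if "m \<le> n" for n
      using that by (induction rule: dec_induct) (use start persist in blast)+
    moreover have "occurs (approx n) (p n) (l n) (p (Suc n))" "l (Suc n) = step (l n)" "\<forall>c\<in>C. p n \<le> c n" if "m \<le> n" for n
      using occurs_left[OF blockD(1)[OF b that]] blockD(2,3)[OF b that] by simp_all
    ultimately have "block m p l C" unfolding block_def by blast
    then show ?thesis using m0 by blast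
  next
    assume start: "\<forall>c\<in>C. p m + len (l m) + k m \<le> c m"
    have "\<forall>c\<in>C. p n + len (l n) + k n \<le> c n" if "m \<le> n" for n
      using that by (induction rule: dec_induct) (use start persist in blast)+
    moreover have "occurs (approx n) (p n + len (l n) + k n) (r n) (p (Suc n) + len (l (Suc n)) + k (Suc n))"
      "r (Suc n) = step (r n)" "\<forall>c\<in>C. c n \<le> p n + len (l n) + k n + len (r n)" if "m \<le> n" for n
      using occurs_right[OF blockD(1)[OF b that]] blockD(2,4)[OF b that] by (simp_all add: add.assoc)
    ultimately have "block m (\<lambda>n. p n + len (l n) + k n) r C" unfolding block_def by blast
    then show ?thesis using m0 by blast
  qed
qed

text \<open>Either the set is caught by a leaf when that leaf is inserted, or it stays in the
  \<open>Pend\<close> for ever. In the latter case it lies in the evolution of \<open>v\<close> at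
  all stages, since \<open>Pend\<close> adds no points to the arc.\<close>

lemma pend_split:
  assumes b: "block m p u C" and u: "u m = Pend v c0 s j0"
    and C: "C \<subseteq> limit_space" "connected C" "C \<noteq> {}" and no: "\<nexists>m p l k r. on_edge C m p l k r"
  shows "(\<exists>w. block m p w C \<and> w m = v) \<or> (\<exists>n j. m < n \<and> at_leaf C n (j # s))"
proof (rule disjCI)
  assume nl: "\<nexists>n j. m < n \<and> at_leaf C n (j # s)"
  define w where "w n = (step ^^ (n - m)) v" for n
  have w: "w m = v" "m \<le> n \<Longrightarrow> w (Suc n) = step (w n)" for n
    by (simp_all add: w_def Suc_diff_le)
  have pends: "\<exists>u c j. block n p u C \<and> u n = Pend (w n) c s j" if "m \<le> n" for n
    using that
  proof (induction rule: dec_induct)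
    case base
    then show ?case using b u w by auto
  next
    case (step n)
    then obtain u c j where u: "block n p u C" "u n = Pend (w n) c s j" by blast
    have b': "block (Suc n) p u C" using block_later[OF u(1)] by simp
    show ?case
    proof (cases "P (j # s) = {}")
      case True
      then have "\<exists>c. u (Suc n) = Pend (w (Suc n)) c s (Suc j)"
        using blockD(2)[OF u(1) order_refl] u(2) w(2)[OF step(1)] by (simp add: Let_def)
      then show ?thesis using b' by blast
    next
      case False
      then obtain c' k where u': "u (Suc n) = Node (Pend (w (Suc n)) c' s (Suc j)) k (Leaf (j # s))"
        using blockD(2)[OF u(1) order_refl] u(2) w(2)[OF step(1)] by (simp add: Let_def)
      have "m < Suc n" using step(1) by simp
      with node_split[OF b' u' C no] nl False show ?thesis unfolding at_leaf_def by blast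
    qed
  qed
  have "occurs (approx n) (p n) (w n) (p (Suc n)) \<and> (\<forall>c\<in>C. p n \<le> c n \<and> c n \<le> p n + len (w n))" if mn: "m \<le> n" for n
  proof -
    obtain u c j where u: "block n p u C" "u n = Pend (w n) c s j"
      using pends[OF mn] by blast
    show ?thesis
      using blockD(1,3,4)[OF u(1) order_refl] occurs_pend[of "approx n" "p n" "w n" c s j "p (Suc n)"] unfolding u(2) by simp
  qed
  then have "block m p w C" using w(2) unfolding block_def by blast
  then show "\<exists>w. block m p w C \<and> w m = v" using w(1) by blast
qed

lemma leaf_split:
  assumes a: "at_leaf C m s"
    and C: "C \<subseteq> limit_space" "connected C" "C \<noteq> {}" and no: "\<nexists>m p l k r. on_edge C m p l k r"
  shows "\<exists>n j. m < n \<and> at_leaf C n (j # s)"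
proof -
  obtain p u where b: "block m p u C" "u m = Leaf s" "P s \<noteq> {}" using a unfolding at_leaf_def by blast
  have b': "block (Suc m) p u C" "u (Suc m) = step (Leaf s)"
    using block_later[OF b(1), of "Suc m"] blockD(2)[OF b(1) order_refl] b(2) by auto
  obtain i where "P (i # s) \<noteq> {}" using b(3) P_split[of s] by blast
  then have P0: "P (0 # s) \<noteq> {}" using P_empty_mono[of 0 s i] by blast
  have leaf: ?thesis if "block n p u C" "u n = Leaf (j # s)" "P (j # s) \<noteq> {}" "m < n" for n p u j
    using that unfolding at_leaf_def by blast
  consider "P (1 # s) = {}" | "P (1 # s) \<noteq> {}" "P (2 # s) = {}" | "P (1 # s) \<noteq> {}" "P (2 # s) \<noteq> {}" by blast
  then show ?thesis
  proof cases
    case 1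
    then have "u (Suc m) = Leaf (0 # s)" using b' by simp
    then show ?thesis using leaf[OF b'(1) _ P0] by simp
  next
    case 2
    then have "u (Suc m) = Node (Leaf (0 # s)) 1 (Leaf (1 # s))" using b' by simp
    from node_split[OF b'(1) this C no] show ?thesis using leaf[OF _ _ P0] leaf[OF _ _ 2(1)] by blast
  next
    case 3
    then have "u (Suc m) = Node (Pend (Node (Leaf (0 # s)) 1 (Leaf (1 # s))) (1/2) s 3) 1 (Leaf (2 # s))"
      using b' by simp
    from node_split[OF b'(1) this C no] show ?thesis
    proof
      assume "\<exists>p u. block (Suc m) p u C \<and> u (Suc m) = Leaf (2 # s)"
      then show ?thesis using leaf[OF _ _ 3(2)] by blast
    next
      assume "\<exists>u. block (Suc m) p u C \<and> u (Suc m) = Pend (Node (Leaf (0 # s)) 1 (Leaf (1 # s))) (1/2) s 3"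
      then obtain u where "block (Suc m) p u C" "u (Suc m) = Pend (Node (Leaf (0 # s)) 1 (Leaf (1 # s))) (1/2) s 3"
        by blast
      from pend_split[OF this C no] show ?thesis
      proof
        assume "\<exists>w. block (Suc m) p w C \<and> w (Suc m) = Node (Leaf (0 # s)) 1 (Leaf (1 # s))"
        then obtain w where "block (Suc m) p w C" "w (Suc m) = Node (Leaf (0 # s)) 1 (Leaf (1 # s))" by blast
        from node_split[OF this C no] show ?thesis using leaf[OF _ _ P0] leaf[OF _ _ 3(1)] by blast
      qed (use Suc_lessD in blast)
    qed
  qed
qed

text \<open>The basic dichotomy: an edge is hit, or the set sits at leaves with longer and longer
  addresses. It is applied to single points for the end points and to non-degenerate sets for the
  Suslinian property.\<close>

lemma at_leaf_sequence:
  assumes C: "C \<subseteq> limit_space" "connected C" "C \<noteq> {}" and no: "\<nexists>m p l k r. on_edge C m p l k r"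
  shows "\<exists>m s. s 0 = [] \<and> (\<forall>i. (\<exists>j. s (Suc i) = j # s i) \<and> m i < m (Suc i) \<and> at_leaf C (m i) (s i))"
proof -
  have "occurs (approx n) 0 (approx n) 0" for n by (rule occurs.refl)
  then have "block 0 (\<lambda>_. 0) approx C"
    unfolding block_def using C(1) limit_spaceD by (auto simp: approx_Suc)
  then have 0: "at_leaf C 0 []" unfolding at_leaf_def using P_root approx_0 by blast
  have "\<exists>f. \<forall>i. (at_leaf C (fst (f i)) (snd (f i)) \<and> (i = 0 \<longrightarrow> snd (f i) = [])) \<and>
      (fst (f i) < fst (f (Suc i)) \<and> (\<exists>j. snd (f (Suc i)) = j # snd (f i)))"
  proof (rule dependent_nat_choice)
    show "\<exists>x. at_leaf C (fst x) (snd x) \<and> (0 = (0::nat) \<longrightarrow> snd x = [])" using 0 by (intro exI[of _ "(0, [])"]) simp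
    fix x i
    assume "at_leaf C (fst x) (snd x) \<and> ((i::nat) = 0 \<longrightarrow> snd x = [])"
    then obtain n j where "fst x < n" "at_leaf C n (j # snd x)" using leaf_split[OF _ C no] by blast
    then show "\<exists>y. (at_leaf C (fst y) (snd y) \<and> (Suc i = 0 \<longrightarrow> snd y = [])) \<and> fst x < fst y \<and> (\<exists>j. snd y = j # snd x)"
      by (intro exI[of _ "(n, j # snd x)"]) simp
  qed
  then obtain f where f: "\<forall>i. (at_leaf C (fst (f i)) (snd (f i)) \<and> (i = 0 \<longrightarrow> snd (f i) = [])) \<and>
      (fst (f i) < fst (f (Suc i)) \<and> (\<exists>j. snd (f (Suc i)) = j # snd (f i)))" by blast
  then show ?thesis by (intro exI[of _ "\<lambda>i. fst (f i)"] exI[of _ "\<lambda>i. snd (f i)"]) simp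
qed

lemma increasing_unbounded: "(\<And>i. m i < m (Suc i)) \<Longrightarrow> i \<le> (m i :: nat)"
  by (rule seq_suble) (simp add: strict_mono_Suc_iff)

lemma at_leaf_single:
  assumes "at_leaf C m s"
  shows "\<exists>p q. occurs (approx m) p (Leaf s) q \<and> (\<forall>c\<in>C. c m = p)"
proof -
  obtain p u where b: "block m p u C" "u m = Leaf s" using assms unfolding at_leaf_def by blast
  have "c m = p m" if "c \<in> C" for c
    using blockD(3,4)[OF b(1) order_refl that] b(2) by simp
  then show ?thesis using blockD(1)[OF b(1) order_refl] b(2) by auto
qed

text \<open>Within the block of the node, \<open>A\<close> lies before \<open>c\<close> and
  \<open>B\<close> after it. The parts \<open>A'\<close> and \<open>B'\<close> over the two children
  supply points showing that neither side contains the other, against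
  \<open>end_point_nested\<close>.\<close>

lemma edge_not_end_point:
  assumes e: "on_edge {c} m p l k r" and c: "c \<in> limit_space"
  shows "c \<notin> end_points (metric_on limit_space)"
proof
  assume end_pt: "c \<in> end_points (metric_on limit_space)"
  have b: "block m p (\<lambda>n. Node (l n) (k n) (r n)) {c}"
    and em: "p m + len (l m) < c m" "c m < p m + len (l m) + k m"
    using e unfolding on_edge_def by auto
  have edge: "p n + len (l n) < c n" "c n < p n + len (l n) + k n"
    "c (Suc n) = p (Suc n) + (len (step (l n)) + end_value (l n) + (c n - p n))" if "m \<le> n" for n
  proof -
    have "{c} \<subseteq> limit_space" "c \<in> {c}" using c by auto
    from edge_later[OF b this order_refl em that] show "p n + len (l n) < c n" "c n < p n + len (l n) + k n"
      "c (Suc n) = p (Suc n) + (len (step (l n)) + end_value (l n) + (c n - p n))" by blast+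
  qed
  have v: "valid (Node (l n) (k n) (r n))" if "m \<le> n" for n using blockD(5)[OF b that] .
  have nn: "0 \<le> len (l n)" "0 \<le> len (r n)" "0 < k n" if "m \<le> n" for n
    using v[OF that] len_nonneg by auto
  have bnds: "0 \<le> p n" "p n + len (l n) + k n + len (r n) \<le> len (approx n)" if "m \<le> n" for n
    using occurs_bounds[OF blockD(1)[OF b that] valid_approx] by simp_all
  have stp: "l (Suc n) = step (l n)" "k (Suc n) = end_value (l n) + len (Node (l n) (k n) (r n)) + len (r n)" "r (Suc n) = step (r n)"
    if "m \<le> n" for n using blockD(2)[OF b that] by simp_all
  have Fo: "bond (approx n) x = p n + bond (Node (l n) (k n) (r n)) (x - p (Suc n))"
    if "m \<le> n" "p (Suc n) \<le> x" "x \<le> p (Suc n) + len (step (Node (l n) (k n) (r n)))" for n x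
    using bond_occurs[OF blockD(1)[OF b that(1)] valid_approx, of "x - p (Suc n)"] that by simp
  \<comment> \<open>Bounds from stage \<open>m\<close> on, with the full arcs before, describe an
    inverse limit of intervals.\<close>
  have sub: "compact S \<and> connected S \<and> S \<noteq> {} \<and> S \<subseteq> limit_space"
    if S: "S = {x \<in> limit_space. \<forall>n\<ge>m. \<alpha> n \<le> x n \<and> x n \<le> \<beta> n}"
      and ab: "\<And>n. m \<le> n \<Longrightarrow> 0 \<le> \<alpha> n \<and> \<alpha> n \<le> \<beta> n \<and> \<beta> n \<le> len (approx n)"
      and im: "\<And>n x. m \<le> n \<Longrightarrow> \<alpha> (Suc n) \<le> x \<Longrightarrow> x \<le> \<beta> (Suc n) \<Longrightarrow>
        \<alpha> n \<le> bond (approx n) x \<and> bond (approx n) x \<le> \<beta> n" for \<alpha> \<beta> S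
  proof -
    define \<alpha>' \<beta>' where "\<alpha>' n = (if n < m then 0 else \<alpha> n)" and "\<beta>' n = (if n < m then len (approx n) else \<beta> n)" for n
    have ab': "0 \<le> \<alpha>' n" "\<alpha>' n \<le> \<beta>' n" "\<beta>' n \<le> len (approx n)" for n
      using ab[of n] len_nonneg[OF valid_approx] by (auto simp: \<alpha>'_def \<beta>'_def)
    have S': "S = inverse_limit (\<lambda>n. bond (approx n)) (\<lambda>n. {\<alpha>' n..\<beta>' n})"
    proof (intro set_eqI iffI)
      fix x assume "x \<in> S"
      then have "x \<in> limit_space" "\<And>n. m \<le> n \<Longrightarrow> \<alpha> n \<le> x n \<and> x n \<le> \<beta> n" unfolding S by blast+
      moreover from this have "\<alpha>' n \<le> x n \<and> x n \<le> \<beta>' n" for n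
        using limit_spaceD(1,2)[of x n] by (simp add: \<alpha>'_def \<beta>'_def)
      ultimately show "x \<in> inverse_limit (\<lambda>n. bond (approx n)) (\<lambda>n. {\<alpha>' n..\<beta>' n})"
        unfolding inverse_limit_def using limit_spaceD(3)[of x] by simp
    next
      fix x assume "x \<in> inverse_limit (\<lambda>n. bond (approx n)) (\<lambda>n. {\<alpha>' n..\<beta>' n})"
      then have "\<forall>n. x n \<in> {\<alpha>' n..\<beta>' n} \<and> x n = bond (approx n) (x (Suc n))"
        unfolding inverse_limit_def by (rule CollectD)
      then have x: "\<And>n. \<alpha>' n \<le> x n" "\<And>n. x n \<le> \<beta>' n" "\<And>n. x n = bond (approx n) (x (Suc n))"
        by (meson atLeastAtMost_iff)+
      have "x n \<in> {0..len (approx n)}" for n using x(1)[of n] x(2)[of n] ab'[of n] by simp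
      then have "x \<in> limit_space" unfolding limit_space_def inverse_limit_def using x(3) by blast
      moreover have "\<alpha> n \<le> x n \<and> x n \<le> \<beta> n" if "m \<le> n" for n
        using x(1,2)[of n] that by (simp add: \<alpha>'_def \<beta>'_def)
      ultimately show "x \<in> S" unfolding S by blast
    qed
    have co: "continuous_on {\<alpha>' (Suc n)..\<beta>' (Suc n)} (bond (approx n))" for n
      by (rule continuous_on_subset[OF continuous_on_bond[OF valid_approx]]) (use ab'[of "Suc n"] in \<open>auto simp: approx_Suc\<close>)
    have im': "bond (approx n) x \<in> {\<alpha>' n..\<beta>' n}" if "x \<in> {\<alpha>' (Suc n)..\<beta>' (Suc n)}" for n x
    proof (cases "n < m")
      case True
      have "0 \<le> x" "x \<le> len (step (approx n))" using that ab'[of "Suc n"] by (auto simp: approx_Suc)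
      then show ?thesis using bond_range[OF valid_approx] True by (simp add: \<alpha>'_def \<beta>'_def)
    next
      case False
      then show ?thesis using im[of n x] that by (simp add: \<alpha>'_def \<beta>'_def)
    qed
    show ?thesis
      using inverse_limit_continuum[where f = "\<lambda>n. bond (approx n)", OF ab'(2) co im'] unfolding S'[symmetric] using S by blast
  qed
  define A where "A = {x \<in> limit_space. \<forall>n\<ge>m. p n \<le> x n \<and> x n \<le> c n}"
  define B where "B = {x \<in> limit_space. \<forall>n\<ge>m. c n \<le> x n \<and> x n \<le> p n + len (l n) + k n + len (r n)}"
  define A' where "A' = {x \<in> limit_space. \<forall>n\<ge>m. p n \<le> x n \<and> x n \<le> p n + len (l n)}"
  define B' where "B' = {x \<in> limit_space. \<forall>n\<ge>m. p n + len (l n) + k n \<le> x n \<and> x n \<le> p n + len (l n) + k n + len (r n)}"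
  have A: "compact A \<and> connected A \<and> A \<noteq> {} \<and> A \<subseteq> limit_space"
  proof (rule sub[OF A_def])
    show "0 \<le> p n \<and> p n \<le> c n \<and> c n \<le> len (approx n)" if "m \<le> n" for n
      using bnds[OF that] edge(1,2)[OF that] nn[OF that] by simp
    fix n x assume n: "m \<le> n" and x: "p (Suc n) \<le> x" "x \<le> c (Suc n)"
    have "x \<le> p (Suc n) + len (step (Node (l n) (k n) (r n)))"
      using x(2) edge(2)[of "Suc n"] n stp[OF n] nn[of "Suc n"] by simp
    note Fx = Fo[OF n x(1) this]
    have "0 \<le> bond (Node (l n) (k n) (r n)) (x - p (Suc n))"
      using bond_range[OF v[OF n], of "x - p (Suc n)"] x \<open>x \<le> p (Suc n) + _\<close> by simp
    moreover have "bond (Node (l n) (k n) (r n)) (x - p (Suc n)) \<le> c n - p n"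
      by (rule bond_node_lower[OF v[OF n]]) (use x edge[OF n] in auto)
    ultimately show "p n \<le> bond (approx n) x \<and> bond (approx n) x \<le> c n" unfolding Fx by linarith
  qed
  have A': "compact A' \<and> connected A' \<and> A' \<noteq> {} \<and> A' \<subseteq> limit_space"
  proof (rule sub[OF A'_def])
    show "0 \<le> p n \<and> p n \<le> p n + len (l n) \<and> p n + len (l n) \<le> len (approx n)" if "m \<le> n" for n
      using bnds[OF that] nn[OF that] by simp
    fix n x assume n: "m \<le> n" and x: "p (Suc n) \<le> x" "x \<le> p (Suc n) + len (l (Suc n))"
    have "bond (approx n) (p (Suc n) + (x - p (Suc n))) = p n + bond (l n) (x - p (Suc n))"
      by (rule bond_occurs[OF occurs_left[OF blockD(1)[OF b n]] valid_approx]) (use x stp[OF n] in auto)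
    moreover have "0 \<le> bond (l n) (x - p (Suc n)) \<and> bond (l n) (x - p (Suc n)) \<le> len (l n)"
      by (rule bond_range) (use x stp[OF n] v[OF n] in auto)
    ultimately show "p n \<le> bond (approx n) x \<and> bond (approx n) x \<le> p n + len (l n)" by simp
  qed
  have B: "compact B \<and> connected B \<and> B \<noteq> {} \<and> B \<subseteq> limit_space"
  proof (rule sub[OF B_def])
    show "0 \<le> c n \<and> c n \<le> p n + len (l n) + k n + len (r n) \<and> p n + len (l n) + k n + len (r n) \<le> len (approx n)" if "m \<le> n" for n
      using bnds[OF that] edge(1,2)[OF that] nn[OF that] by simp
    fix n x assume n: "m \<le> n" and x: "c (Suc n) \<le> x" "x \<le> p (Suc n) + len (l (Suc n)) + k (Suc n) + len (r (Suc n))"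
    have x1: "p (Suc n) \<le> x" using x(1) edge(1)[of "Suc n"] n nn[of "Suc n"] by simp
    have x2: "x \<le> p (Suc n) + len (step (Node (l n) (k n) (r n)))" using x(2) stp[OF n] by simp
    note Fx = Fo[OF n x1 x2]
    have "bond (Node (l n) (k n) (r n)) (x - p (Suc n)) \<le> len (Node (l n) (k n) (r n))"
      using bond_range[OF v[OF n], of "x - p (Suc n)"] x1 x2 by simp
    moreover have "c n - p n \<le> bond (Node (l n) (k n) (r n)) (x - p (Suc n))"
      by (rule bond_node_upper[OF v[OF n]]) (use x x2 edge[OF n] in auto)
    ultimately show "c n \<le> bond (approx n) x \<and> bond (approx n) x \<le> p n + len (l n) + k n + len (r n)"
      unfolding Fx by (simp del: bond.simps)
  qed
  have B': "compact B' \<and> connected B' \<and> B' \<noteq> {} \<and> B' \<subseteq> limit_space"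
  proof (rule sub[OF B'_def])
    show "0 \<le> p n + len (l n) + k n \<and> p n + len (l n) + k n \<le> p n + len (l n) + k n + len (r n) \<and>
        p n + len (l n) + k n + len (r n) \<le> len (approx n)" if "m \<le> n" for n
      using bnds[OF that] nn[OF that] by simp
    fix n x assume n: "m \<le> n" and x: "p (Suc n) + len (l (Suc n)) + k (Suc n) \<le> x"
      "x \<le> p (Suc n) + len (l (Suc n)) + k (Suc n) + len (r (Suc n))"
    define q where "q = p (Suc n) + len (step (l n)) + (end_value (l n) + len (Node (l n) (k n) (r n)) + len (r n))"
    have q: "0 \<le> x - q" "x - q \<le> len (step (r n))" using x stp[OF n] unfolding q_def by simp_all
    have "bond (approx n) (q + (x - q)) = p n + len (l n) + k n + bond (r n) (x - q)"
      unfolding q_def by (rule bond_occurs[OF occurs_right[OF blockD(1)[OF b n]] valid_approx]) (use q in \<open>simp_all only: q_def\<close>)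
    moreover have "0 \<le> bond (r n) (x - q) \<and> bond (r n) (x - q) \<le> len (r n)"
      by (rule bond_range) (use q v[OF n] in auto)
    ultimately show "p n + len (l n) + k n \<le> bond (approx n) x \<and> bond (approx n) x \<le> p n + len (l n) + k n + len (r n)" by simp
  qed
  have "p n \<le> c n \<and> c n \<le> c n \<and> c n \<le> p n + len (l n) + k n + len (r n)" if "m \<le> n" for n
    using edge(1,2)[OF that] nn[OF that] by linarith
  then have cA: "c \<in> A" and cB: "c \<in> B" unfolding A_def B_def using c by blast+
  obtain a where a: "a \<in> limit_space" "\<And>n. m \<le> n \<Longrightarrow> p n \<le> a n \<and> a n \<le> p n + len (l n)"
    using A' unfolding A'_def by blast
  have "\<not> c m \<le> a m" using a(2)[OF order_refl] em by linarith
  then have "a \<notin> B" unfolding B_def by blast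
  moreover have "p n \<le> a n \<and> a n \<le> c n" if "m \<le> n" for n
    using a(2)[OF that] edge(1)[OF that] by linarith
  then have "a \<in> A" unfolding A_def using a(1) by blast
  ultimately have 1: "\<not> A \<subseteq> B" by blast
  obtain d where d: "d \<in> limit_space"
    "\<And>n. m \<le> n \<Longrightarrow> p n + len (l n) + k n \<le> d n \<and> d n \<le> p n + len (l n) + k n + len (r n)"
    using B' unfolding B'_def by blast
  have "\<not> d m \<le> c m" using d(2)[OF order_refl] em by linarith
  then have "d \<notin> A" unfolding A_def by blast
  moreover have "c n \<le> d n \<and> d n \<le> p n + len (l n) + k n + len (r n)" if "m \<le> n" for n
    using d(2)[OF that] edge(2)[OF that] by linarith
  then have "d \<in> B" unfolding B_def using d(1) by blast
  ultimately have 2: "\<not> B \<subseteq> A" by blast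
  show False
    using end_point_nested[OF limit_space_continuum(1) end_pt, of A B] A B cA cB 1 2 compact_imp_closed by blast
qed

lemma suslinian_limit_space: "suslinian (metric_on limit_space)"
proof (rule suslinian_if_countable_hits)
  \<comment> \<open>Each of these sets has at most one element: later coordinates are forced by
    \<open>edge_lift\<close>, earlier ones by the bonding maps.\<close>
  let ?D = "\<lambda>n q. {d \<in> limit_space. d n = q \<and> (\<forall>i\<ge>n. d (Suc i) = edge_lift (approx i) (d i))}"
  show "metric_continuum (metric_on limit_space)"
    using limit_space_continuum by (simp add: metric_continuum_metric_on)
  have "countable (?D n q)" for n q
  proof -
    have "d = d'" if "d \<in> ?D n q" "d' \<in> ?D n q" for d d'
    proof
      fix i
      have "d i = d' i" if "n \<le> i" using that
        by (induction rule: dec_induct) (use \<open>d \<in> ?D n q\<close> \<open>d' \<in> ?D n q\<close> in auto)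
      moreover have "d i = d' i" if "i \<le> n"
        using agree_below[of d d' n i] \<open>d \<in> ?D n q\<close> \<open>d' \<in> ?D n q\<close> that by auto
      ultimately show "d i = d' i" by linarith
    qed
    then have "\<exists>d. ?D n q \<subseteq> {d}" by blast
    then show ?thesis by (meson countable_empty countable_insert countable_subset)
  qed
  then show "countable (\<Union>n. \<Union>q\<in>\<rat>. ?D n q)" by (intro countable_UN countableI_type countable_rat)
  fix K assume K: "compact K" "connected K" "K \<subseteq> limit_space" "nondegenerate K"
  then obtain a b where ab: "a \<in> K" "b \<in> K" "a \<noteq> b" unfolding nondegenerate_def by blast
  have diff: "\<exists>n. \<forall>i\<ge>n. a i \<noteq> b i"
  proof -
    obtain n where "a n \<noteq> b n" using ab(3) by blast
    then have "a i \<noteq> b i" if "n \<le> i" for i using agree_below[of a b i n] ab K(3) that by blast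
    then show ?thesis by blast
  qed
  then obtain n0 where n0: "\<And>i. n0 \<le> i \<Longrightarrow> a i \<noteq> b i" by blast
  show "K \<inter> (\<Union>n. \<Union>q\<in>\<rat>. ?D n q) \<noteq> {}"
  proof (cases "\<exists>m p l k r. on_edge K m p l k r")
    case False
    obtain m s where ms: "\<And>i. m i < m (Suc i)" "\<And>i. at_leaf K (m i) (s i)"
      using at_leaf_sequence[OF K(3,2) _ False] ab(1) by blast
    have "n0 \<le> m n0" using increasing_unbounded[of m] ms(1) by blast
    moreover have "a (m n0) = b (m n0)" using at_leaf_single[OF ms(2)[of n0]] ab by metis
    ultimately show ?thesis using n0 by blast
  next
    case True
    then obtain m p l k r c where b: "block m p (\<lambda>n. Node (l n) (k n) (r n)) K"
      and c: "c \<in> K" "p m + len (l m) < c m" "c m < p m + len (l m) + k m"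
      unfolding on_edge_def by blast
    \<comment> \<open>Late enough for \<open>c\<close> to be on the edge and for the coordinates of
      \<open>K\<close> to fill a non-degenerate interval, which then contains a rational point of
      the edge.\<close>
    define n where "n = max m n0"
    have n: "m \<le> n" "n0 \<le> n" by (simp_all add: n_def)
    have cn: "p n + len (l n) < c n" "c n < p n + len (l n) + k n"
      using edge_later[OF b K(3) c(1) order_refl c(2,3) n(1)] by simp_all
    have conn: "connected ((\<lambda>c. c n) ` K)"
      by (rule connected_continuous_image[OF continuous_on_subset[OF continuous_on_product_coordinates] K(2)]) simp
    obtain z where z: "z \<in> K" "z n \<noteq> c n" using n0[OF n(2)] ab by metis
    have "\<exists>q\<in>\<rat>. q \<in> (\<lambda>c. c n) ` K \<and> p n + len (l n) < q \<and> q < p n + len (l n) + k n"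
    proof (cases "c n < z n")
      case True
      then obtain q where q: "q \<in> \<rat>" "c n < q" "q < min (z n) (p n + len (l n) + k n)"
        using Rats_dense_in_real[of "c n" "min (z n) (p n + len (l n) + k n)"] cn by auto
      have "q \<in> (\<lambda>c. c n) ` K"
        by (rule connectedD_interval[OF conn, of "c n" "z n"]) (use c z q in auto)
      then show ?thesis using q cn by (intro bexI[of _ q]) auto
    next
      case False
      then obtain q where q: "q \<in> \<rat>" "max (z n) (p n + len (l n)) < q" "q < c n"
        using Rats_dense_in_real[of "max (z n) (p n + len (l n))" "c n"] cn z by auto
      have "q \<in> (\<lambda>c. c n) ` K"
        by (rule connectedD_interval[OF conn, of "z n" "c n"]) (use c z q in auto)
      then show ?thesis using q cn by (intro bexI[of _ q]) auto
    qed
    then obtain d where d: "d \<in> K" "d n \<in> \<rat>" "p n + len (l n) < d n" "d n < p n + len (l n) + k n" by auto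
    then have "d (Suc i) = edge_lift (approx i) (d i)" if "n \<le> i" for i
      using edge_later[OF b K(3) d(1) n(1) d(3,4) that] by blast
    then have "d \<in> ?D n (d n)" using d(1) K(3) by blast
    then show ?thesis using d(1,2) by blast
  qed
qed

end

subsection \<open>The space of end points\<close>

lemma continuous_map_if_clopen:
  assumes A: "openin X A" "closedin X A" and f: "continuous_map X Y f" and g: "continuous_map X Y g"
  shows "continuous_map X Y (\<lambda>x. if x \<in> A then f x else g x)"
  unfolding continuous_map_def
proof (intro conjI allI impI)
  show "(\<lambda>x. if x \<in> A then f x else g x) \<in> topspace X \<rightarrow> topspace Y"
    using f g by (auto simp: continuous_map_def)
  fix U assume "openin Y U"
  then have "openin X {x \<in> topspace X. f x \<in> U}" "openin X {x \<in> topspace X. g x \<in> U}"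
    using f g by (auto simp: continuous_map_def)
  then have "openin X (A \<inter> {x \<in> topspace X. f x \<in> U} \<union> ({x \<in> topspace X. g x \<in> U} - A))"
    using A by (intro openin_Un openin_Int openin_diff)
  moreover have "A \<inter> {x \<in> topspace X. f x \<in> U} \<union> ({x \<in> topspace X. g x \<in> U} - A) =
      {x \<in> topspace X. (if x \<in> A then f x else g x) \<in> U}" by auto
  ultimately show "openin X {x \<in> topspace X. (if x \<in> A then f x else g x) \<in> U}" by simp
qed

text \<open>The topological half of the scheme: \<open>P_small\<close> makes the topology readable
  from late leaves, and \<open>P_nested\<close> is the form in which completeness is used.\<close>

locale clopen_splitting = splitting P for P :: "nat list \<Rightarrow> 'a set" +
  fixes G :: "'a topology"
  assumes P_topspace: "P [] = topspace G"
    and P_open: "openin G (P s)" and P_closed: "closedin G (P s)"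
    and P_small: "openin G U \<Longrightarrow> x \<in> U \<Longrightarrow> \<exists>N. \<forall>s. N \<le> length s \<longrightarrow> x \<in> P s \<longrightarrow> P s \<subseteq> U"
    and P_nested: "(\<And>i. \<exists>j. \<sigma> (Suc i) = j # \<sigma> i) \<Longrightarrow> (\<And>i. P (\<sigma> i) \<noteq> {}) \<Longrightarrow> \<sigma> 0 = [] \<Longrightarrow> \<exists>x. \<forall>i. x \<in> P (\<sigma> i)"
    and G_t1: "t1_space G"
begin

text \<open>An end point is never on an edge, so it visits leaves along a branch. A point
  \<open>x\<close> common to that branch has a thread agreeing with it at infinitely many stages,
  hence at all.\<close>

lemma end_points_eq: "end_points (metric_on limit_space) = thread ` P []"
proof
  show "thread ` P [] \<subseteq> end_points (metric_on limit_space)" using thread_end_point by blast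
  show "end_points (metric_on limit_space) \<subseteq> thread ` P []"
  proof
    fix c assume c: "c \<in> end_points (metric_on limit_space)"
    then have cX: "c \<in> limit_space" by (simp add: end_points_def)
    have "\<nexists>m p l k r. on_edge {c} m p l k r" using edge_not_end_point cX c by blast
    from at_leaf_sequence[OF _ _ _ this] cX obtain m s where
      s: "s 0 = []" "\<And>i. \<exists>j. s (Suc i) = j # s i" and m: "\<And>i. m i < m (Suc i)" and leaf: "\<And>i. at_leaf {c} (m i) (s i)"
      by (metis connected_sing empty_not_insert empty_subsetI insert_subset)
    have "P (s i) \<noteq> {}" for i using leaf unfolding at_leaf_def by blast
    from P_nested[OF s(2) this s(1)] obtain x where x: "\<And>i. x \<in> P (s i)" by blast
    have x0: "x \<in> P []" using x[of 0] s(1) by simp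
    have "thread x (m i) = c (m i)" for i
    proof -
      obtain p q where p: "occurs (approx (m i)) p (Leaf (s i)) q" "c (m i) = p"
        using at_leaf_single[OF leaf[of i]] by blast
      then show ?thesis using place_occurs[OF p(1) separated_approx, of x] x[of i] by (simp add: thread_def)
    qed
    then have "c i = thread x i" for i
      using agree_below[OF thread_mem[OF x0] cX _ increasing_unbounded[of m, OF m]] by metis
    then have "c = thread x" by blast
    then show "c \<in> thread ` P []" using x0 by blast
  qed
qed

lemma content_clopen: "openin G (content t) \<and> closedin G (content t)"
proof (induction t)
  case (Pend t c s j)
  have "openin G (\<Union>i\<in>{j..}. P (i # s))" using P_open by blast
  \<comment> \<open>An infinite union of closed parts need not be closed, but this tail is the
    complement in \<open>P s\<close> of finitely many open parts.\<close>
  moreover have "closedin G (P s - (\<Union>i<j. P (i # s)))" using P_open P_closed by (intro closedin_diff) auto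
  moreover have "(\<Union>i\<in>{j..}. P (i # s)) = P s - (\<Union>i<j. P (i # s))"
    unfolding P_split_first[of s j] by (auto dest: P_same_index)
  ultimately show ?case using Pend by auto
qed (auto simp: P_open P_closed)

lemma place_continuous: "continuous_map G euclideanreal (place t)"
proof (induction t)
  case (Node l k r)
  have "continuous_map G euclideanreal (\<lambda>x. if x \<in> content l then place l x else len l + k + place r x)"
    using content_clopen Node by (intro continuous_map_if_clopen continuous_map_add) auto
  then show ?case by simp
next
  case (Pend t c s j)
  have "continuous_map G euclideanreal (\<lambda>x. if x \<in> content t then place t x else c)"
    using content_clopen Pend by (intro continuous_map_if_clopen) auto
  then show ?case by simp
qed simp

lemma finite_range_place: "finite (range (place t))"
proof (induction t)
  case (Node l k r)
  then have "finite (range (place l) \<union> (\<lambda>y. len l + k + y) ` range (place r))" by blast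
  then show ?case by (rule finite_subset[rotated]) auto
next
  case (Pend t c s j)
  then have "finite (insert c (range (place t)))" by blast
  then show ?case by (rule finite_subset[rotated]) auto
qed simp

lemma thread_homeomorphic: "homeomorphic_map G (top_of_set (end_points (metric_on limit_space))) thread"
proof (rule bijective_open_imp_homeomorphic_map)
  \<comment> \<open>At a stage where \<open>x\<close> sits at the leaf of a small part, the
    coordinate alone tells whether \<open>y\<close> belongs to that part.\<close>
  have near: "\<exists>n. \<forall>y\<in>P []. thread y n = thread x n \<longrightarrow> y \<in> U" if U: "openin G U" "x \<in> U" for x U
  proof -
    have x: "x \<in> P []" using U openin_subset P_topspace by blast
    obtain N where N: "\<And>s. N \<le> length s \<Longrightarrow> x \<in> P s \<Longrightarrow> P s \<subseteq> U" using P_small[OF U] by blast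
    obtain n s q where n: "N \<le> length s" "x \<in> P s" "occurs (approx n) (thread x n) (Leaf s) q"
      using thread_at_leaf[OF x, of N] by blast
    have "y \<in> P s" if "y \<in> P []" "thread y n = thread x n" for y
      using occurs_leaf_unique[OF n(3) HOL.refl valid_approx, of y] that content_approx by (simp add: thread_def)
    then show ?thesis using N[OF n(1,2)] by blast
  qed
  have "continuous_map G (product_topology (\<lambda>_. euclidean) UNIV) thread"
    unfolding continuous_map_componentwise_UNIV thread_def using place_continuous by blast
  then have "continuous_map G euclidean thread" by (simp only: euclidean_product_topology)
  then show "continuous_map G (top_of_set (end_points (metric_on limit_space))) thread"
    using P_topspace by (auto simp: continuous_map_in_subtopology end_points_eq)
  show "thread ` topspace G = topspace (top_of_set (end_points (metric_on limit_space)))"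
    by (simp add: end_points_eq P_topspace)
  show "inj_on thread (topspace G)"
  proof (rule inj_onI)
    fix x y assume xy: "x \<in> topspace G" "y \<in> topspace G" "thread x = thread y"
    show "x = y"
    proof (rule ccontr)
      assume "x \<noteq> y"
      then obtain U where U: "openin G U" "x \<in> U" "y \<notin> U" using G_t1 xy unfolding t1_space_def by blast
      then show False using near[OF U(1,2)] xy P_topspace by auto
    qed
  qed
  show "open_map G (top_of_set (end_points (metric_on limit_space))) thread"
    unfolding open_map_def
  proof (intro allI impI)
    fix U assume U: "openin G U"
    have UP: "U \<subseteq> P []" using openin_subset[OF U] P_topspace by simp
    show "openin (top_of_set (end_points (metric_on limit_space))) (thread ` U)"
    proof (subst openin_subopen, intro ballI)
      fix c assume "c \<in> thread ` U"
      then obtain x where x: "x \<in> U" "c = thread x" by blast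
      obtain n where n: "\<And>y. y \<in> P [] \<Longrightarrow> thread y n = thread x n \<Longrightarrow> y \<in> U" using near[OF U x(1)] by blast
      \<comment> \<open>Threads take only finitely many values at a stage, so prescribing the exact
        value is an open condition on them.\<close>
      define W where "W = - (range (place (approx n)) - {thread x n})"
      have "open W" unfolding W_def
        by (intro open_Compl finite_imp_closed finite_Diff finite_range_place)
      then have "open ((\<lambda>c. c n) -` W)"
        using continuous_on_product_coordinates by (rule open_vimage)
      then have "openin (top_of_set (end_points (metric_on limit_space))) (end_points (metric_on limit_space) \<inter> (\<lambda>c. c n) -` W)"
        by blast
      moreover have "c \<in> end_points (metric_on limit_space) \<inter> (\<lambda>c. c n) -` W"
        using x UP by (auto simp: end_points_eq W_def)
      moreover have "end_points (metric_on limit_space) \<inter> (\<lambda>c. c n) -` W \<subseteq> thread ` U"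
        using n by (auto simp: end_points_eq W_def thread_def)
      ultimately show "\<exists>T. openin (top_of_set (end_points (metric_on limit_space))) T \<and> c \<in> T \<and> T \<subseteq> thread ` U"
        by blast
    qed
  qed
qed

end

section \<open>Clopen partitions of zero-dimensional Polish spaces\<close>

text \<open>This provides \<open>P_initial\<close>: the distinct non-empty members are enumerated
  along an initial segment of the natural numbers.\<close>

lemma compress_disjoint_sequence:
  fixes A :: "nat \<Rightarrow> 'a set"
  assumes "disjoint_family A"
  shows "\<exists>B :: nat \<Rightarrow> 'a set. disjoint_family B \<and> (\<Union>n. B n) = (\<Union>n. A n) \<and> range B \<subseteq> insert {} (range A) \<and>
    (\<forall>n. B (Suc n) \<noteq> {} \<longrightarrow> B n \<noteq> {})"
proof -
  define Q where "Q = range A - {{}}"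
  have "countable Q" unfolding Q_def by simp
  have dis: "C \<inter> D = {}" if "C \<in> Q" "D \<in> Q" "C \<noteq> D" for C D
  proof -
    obtain i j where "C = A i" "D = A j" using \<open>C \<in> Q\<close> \<open>D \<in> Q\<close> unfolding Q_def by blast
    then show ?thesis using assms \<open>C \<noteq> D\<close> unfolding disjoint_family_on_def by (cases "i = j") auto
  qed
  obtain I :: "nat set" and e where e: "bij_betw e I Q" and I: "\<And>n. Suc n \<in> I \<Longrightarrow> n \<in> I"
  proof (cases "finite Q")
    case True
    then obtain e where "bij_betw e {0..<card Q} Q" using ex_bij_betw_nat_finite by blast
    then show ?thesis using that[of e "{0..<card Q}"] by auto
  next
    case False
    then have "bij_betw (from_nat_into Q) UNIV Q" using \<open>countable Q\<close> by (rule bij_betw_from_nat_into[rotated])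
    then show ?thesis using that[of "from_nat_into Q" UNIV] by auto
  qed
  define B where "B n = (if n \<in> I then e n else {})" for n
  have eQ: "e n \<in> Q" if "n \<in> I" for n using e that bij_betwE by blast
  have "disjoint_family B"
    unfolding disjoint_family_on_def
  proof (intro ballI impI)
    fix i j :: nat assume "i \<noteq> j"
    then have "e i \<noteq> e j" if "i \<in> I" "j \<in> I" using e that unfolding bij_betw_def inj_on_def by blast
    then show "B i \<inter> B j = {}" using dis eQ unfolding B_def by auto
  qed
  moreover have "(\<Union>n. B n) = \<Union>Q"
    using bij_betw_imp_surj_on[OF e] unfolding B_def by (auto split: if_splits)
  moreover have "\<Union>Q = (\<Union>n. A n)" unfolding Q_def by auto
  moreover have "range B \<subseteq> insert {} (range A)" using eQ unfolding B_def Q_def by auto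
  moreover have "B (Suc n) \<noteq> {} \<longrightarrow> B n \<noteq> {}" for n
    using I eQ[of n] unfolding B_def Q_def by auto
  ultimately show ?thesis by (intro exI[of _ B]) simp
qed

lemma (in Metric_space) countable_subcover:
  assumes "separable_space mtopology" and U: "\<And>U. U \<in> \<U> \<Longrightarrow> openin mtopology U" "M \<subseteq> \<Union>\<U>"
  shows "\<exists>\<V>. countable \<V> \<and> \<V> \<subseteq> \<U> \<and> M \<subseteq> \<Union>\<V>"
proof -
  obtain C where C: "countable C" "C \<subseteq> M" "mtopology closure_of C = M"
    using assms(1) unfolding separable_space_def by auto
  define I where "I = {(c, q). c \<in> C \<and> q \<in> \<rat> \<and> (\<exists>U\<in>\<U>. mball c q \<subseteq> U)}"
  define f where "f = (\<lambda>(c, q). SOME U. U \<in> \<U> \<and> mball c q \<subseteq> U)"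
  have f: "f (c, q) \<in> \<U> \<and> mball c q \<subseteq> f (c, q)" if "(c, q) \<in> I" for c q
    unfolding f_def prod.case by (rule someI_ex) (use that in \<open>auto simp: I_def\<close>)
  have "countable (C \<times> \<rat> :: ('a \<times> real) set)" using C(1) countable_rat by blast
  moreover have "I \<subseteq> C \<times> \<rat>" unfolding I_def by blast
  ultimately have "countable (f ` I)" using countable_subset by blast
  moreover have "f ` I \<subseteq> \<U>" using f by auto
  moreover have "M \<subseteq> \<Union>(f ` I)"
  proof
    fix x assume x: "x \<in> M"
    then obtain U where "U \<in> \<U>" "x \<in> U" using U(2) by blast
    then obtain r where r: "r > 0" "mball x r \<subseteq> U" using U(1) openin_mtopology by blast
    have "x \<in> mtopology closure_of C" using x C(3) by simp
    moreover have "openin mtopology (mball x (r / 2))" "x \<in> mball x (r / 2)" using x r by auto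
    ultimately obtain c where c: "c \<in> C" "c \<in> mball x (r / 2)" unfolding in_closure_of by blast
    then have dc: "d x c < r / 2" "c \<in> M" by auto
    obtain q where q: "q \<in> \<rat>" "d x c < q" "q < r / 2" using Rats_dense_in_real[OF dc(1)] by blast
    have "mball c q \<subseteq> mball x r"
    proof
      fix y assume "y \<in> mball c q"
      then have "d c y < q" "y \<in> M" by auto
      then show "y \<in> mball x r" using triangle[OF x dc(2), of y] dc q x by auto
    qed
    then have "(c, q) \<in> I" unfolding I_def using c q r \<open>U \<in> \<U>\<close> by blast
    moreover have "x \<in> mball c q" using q(2) dc x commute[of x c] by auto
    ultimately show "x \<in> \<Union>(f ` I)" using f by blast
  qed
  ultimately show ?thesis by blast
qed

text \<open>A countable cover by small clopen sets is made disjoint by removing the finitely many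
  earlier members, which keeps the pieces clopen.\<close>

lemma (in Metric_space) clopen_partition:
  assumes zd: "zero_dimensional_space mtopology" and sep: "separable_space mtopology" and "\<epsilon> > 0"
    and S: "openin mtopology S" "closedin mtopology S"
  shows "\<exists>Q :: nat \<Rightarrow> 'a set. disjoint_family Q \<and> (\<Union>n. Q n) = S \<and>
    (\<forall>n. openin mtopology (Q n) \<and> closedin mtopology (Q n) \<and> (\<forall>x\<in>Q n. \<forall>y\<in>Q n. d x y < \<epsilon>) \<and> (Q (Suc n) \<noteq> {} \<longrightarrow> Q n \<noteq> {}))"
proof -
  obtain \<B> where \<B>: "\<And>U. U \<in> \<B> \<Longrightarrow> openin mtopology U \<and> closedin mtopology U"
    "openin mtopology = arbitrary union_of (\<lambda>U. U \<in> \<B>)"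
    using zd unfolding zero_dimensional_space_def by blast
  define \<U> where "\<U> = {U. openin mtopology U \<and> closedin mtopology U \<and> (\<forall>x\<in>U. \<forall>y\<in>U. d x y < \<epsilon>)}"
  have \<U>_open: "openin mtopology U" if "U \<in> \<U>" for U using that unfolding \<U>_def by blast
  have "M \<subseteq> \<Union>\<U>"
  proof
    fix x assume x: "x \<in> M"
    then have "openin mtopology (mball x (\<epsilon> / 2))" "x \<in> mball x (\<epsilon> / 2)" using \<open>\<epsilon> > 0\<close> by auto
    then obtain U where U: "U \<in> \<B>" "x \<in> U" "U \<subseteq> mball x (\<epsilon> / 2)"
      unfolding \<B>(2) arbitrary_union_of_alt by blast
    have "d y z < \<epsilon>" if "y \<in> U" "z \<in> U" for y z
    proof -
      have "d x y < \<epsilon> / 2" "d x z < \<epsilon> / 2" "y \<in> M" "z \<in> M" using that U by auto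
      then show ?thesis using triangle[of y x z] x commute[of x y] by auto
    qed
    then have "U \<in> \<U>" using \<B>(1)[OF U(1)] unfolding \<U>_def by blast
    then show "x \<in> \<Union>\<U>" using U(2) by blast
  qed
  then obtain \<V> where \<V>: "countable \<V>" "\<V> \<subseteq> \<U>" "M \<subseteq> \<Union>\<V>"
    using countable_subcover[OF sep, of \<U>] \<U>_open by blast
  moreover have "\<Union>\<U> \<subseteq> topspace mtopology" using \<U>_open openin_subset by blast
  ultimately have \<V>: "countable \<V>" "\<V> \<subseteq> \<U>" "\<Union>\<V> = topspace mtopology" by auto
  have "{} \<in> \<U>" unfolding \<U>_def by simp
  then have V': "countable (insert {} \<V>)" "insert {} \<V> \<subseteq> \<U>" "\<Union>(insert {} \<V>) = topspace mtopology" using \<V> by auto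
  define V where "V = from_nat_into (insert {} \<V>)"
  have rV: "range V = insert {} \<V>" unfolding V_def by (rule range_from_nat_into[OF insert_not_empty V'(1)])
  define A where "A n = S \<inter> disjointed V n" for n
  have clop: "openin mtopology (V n) \<and> closedin mtopology (V n) \<and> (\<forall>x\<in>V n. \<forall>y\<in>V n. d x y < \<epsilon>)" for n
  proof -
    have "V n \<in> range V" by simp
    then have "V n \<in> \<U>" unfolding rV using V'(2) by (rule rev_subsetD)
    then show ?thesis unfolding \<U>_def by (rule CollectD)
  qed
  have "disjoint_family A"
    by (rule disjoint_family_subset[OF disjoint_family_disjointed[of V]]) (simp add: A_def)
  from compress_disjoint_sequence[OF this] obtain B where B: "disjoint_family B" "(\<Union>n. B n) = (\<Union>n. A n)" "range B \<subseteq> insert {} (range A)"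
    "\<forall>n. B (Suc n) \<noteq> {} \<longrightarrow> B n \<noteq> {}" by (elim exE conjE)
  have A_clop: "openin mtopology (A n)" "closedin mtopology (A n)" "\<forall>x\<in>A n. \<forall>y\<in>A n. d x y < \<epsilon>" for n
  proof -
    have V: "openin mtopology (V i)" "closedin mtopology (V i)" for i using clop[of i] by simp_all
    have "openin mtopology (\<Union>i\<in>{0..<n}. V i)" by (intro openin_Union) (use V(1) in auto)
    moreover have "closedin mtopology (\<Union>i\<in>{0..<n}. V i)" by (intro closedin_Union) (use V(2) in auto)
    ultimately show "openin mtopology (A n)" "closedin mtopology (A n)"
      unfolding A_def disjointed_def using S V
      by (simp_all add: openin_Int openin_diff closedin_Int closedin_diff)
    have "A n \<subseteq> V n" using disjointed_subset[of V n] unfolding A_def by blast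
    then show "\<forall>x\<in>A n. \<forall>y\<in>A n. d x y < \<epsilon>" using clop[of n] by blast
  qed
  have "(\<Union>n. A n) = S"
  proof -
    have "(\<Union>n. A n) = S \<inter> (\<Union>n. V n)" unfolding A_def UN_disjointed_eq[of V, symmetric] by blast
    also have "(\<Union>n. V n) = topspace mtopology" using rV V'(3) by simp
    finally show ?thesis using openin_subset[OF S(1)] by blast
  qed
  moreover have "openin mtopology (B n) \<and> closedin mtopology (B n) \<and> (\<forall>x\<in>B n. \<forall>y\<in>B n. d x y < \<epsilon>)" for n
  proof -
    have "B n = {} \<or> (\<exists>k. B n = A k)" using B(3) by blast
    then show ?thesis using A_clop by auto
  qed
  ultimately show ?thesis using B by (intro exI[of _ B]) simp
qed

lemma (in Metric_space) clopen_splitting_exists: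
  assumes zd: "zero_dimensional_space mtopology" and sep: "separable_space mtopology" and comp: mcomplete
  shows "\<exists>P. clopen_splitting P mtopology"
proof -
  define good where "good S \<epsilon> Q \<longleftrightarrow> disjoint_family Q \<and> (\<Union>n. Q n) = S \<and>
    (\<forall>n. openin mtopology (Q n) \<and> closedin mtopology (Q n) \<and> (\<forall>x\<in>Q n. \<forall>y\<in>Q n. d x y < \<epsilon>) \<and> (Q (Suc n) \<noteq> {} \<longrightarrow> Q n \<noteq> {}))"
    for S \<epsilon> and Q :: "nat \<Rightarrow> 'a set"
  define q where "q S \<epsilon> = (SOME Q. good S \<epsilon> Q)" for S \<epsilon>
  have q: "good S \<epsilon> (q S \<epsilon>)" if "openin mtopology S" "closedin mtopology S" "\<epsilon> > 0" for S \<epsilon>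
    unfolding q_def using clopen_partition[OF zd sep that(3,1,2)] unfolding good_def by (rule someI_ex)
  \<comment> \<open>A part with address \<open>j # s\<close> has distances below 1 / (length s + 1),
    so diameters tend to 0 along every branch and completeness yields a common point.\<close>
  define P where "P = rec_list M (\<lambda>j s S. q S (1 / real (Suc (length s))) j)"
  have P: "P [] = M" "P (j # s) = q (P s) (1 / real (Suc (length s))) j" for j s
    by (simp_all add: P_def)
  have clop: "openin mtopology (P s) \<and> closedin mtopology (P s)" for s
  proof (induction s)
    case Nil
    then show ?case using openin_topspace[of mtopology] closedin_topspace[of mtopology] by (simp add: P)
  next
    case (Cons j s)
    then have "good (P s) (1 / real (Suc (length s))) (q (P s) (1 / real (Suc (length s))))" by (intro q) auto
    then show ?case unfolding P(2) good_def by blast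
  qed
  have g: "good (P s) (1 / real (Suc (length s))) (\<lambda>j. P (j # s))" for s
    unfolding P(2) using clop by (intro q) auto
  have small: "\<exists>N. \<forall>s. N \<le> length s \<longrightarrow> (\<forall>x\<in>P s. \<forall>y\<in>P s. d x y < \<epsilon>)" if eps: "\<epsilon> > 0" for \<epsilon>
  proof -
    obtain N where N: "inverse (real (Suc N)) < \<epsilon>" using reals_Archimedean[OF eps] by blast
    \<comment> \<open>The root carries no bound on distances, so the length is compared with
      \<open>Suc N\<close>.\<close>
    have "d x y < \<epsilon>" if s_len: "Suc N \<le> length s" and xy: "x \<in> P s" "y \<in> P s" for s x y
    proof -
      obtain j s' where s: "s = j # s'" using s_len by (cases s) auto
      have "d x y < 1 / real (Suc (length s'))" using g[of s'] xy unfolding good_def s by blast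
      also have "\<dots> \<le> inverse (real (Suc N))"
        using s_len s by (simp add: inverse_eq_divide frac_le)
      finally show ?thesis using N by simp
    qed
    then show ?thesis by blast
  qed
  have "clopen_splitting P mtopology"
  proof unfold_locales
    show "P s = (\<Union>j. P (j # s))" for s using g[of s] unfolding good_def by blast
    show "P (i # s) \<inter> P (j # s) = {}" if "i \<noteq> j" for i j s
      using g[of s] that unfolding good_def disjoint_family_on_def by blast
    show "P (j # s) \<noteq> {}" if "P (Suc j # s) \<noteq> {}" for j s using g[of s] that unfolding good_def by blast
    show "P [] \<noteq> {}" using zd by (simp add: P zero_dimensional_space_def)
    show "P [] = topspace mtopology" by (simp add: P)
    show "openin mtopology (P s)" "closedin mtopology (P s)" for s using clop by blast+
    show "t1_space mtopology" using Hausdorff_imp_t1_space Hausdorff_space_mtopology by blast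
    show "\<exists>N. \<forall>s. N \<le> length s \<longrightarrow> x \<in> P s \<longrightarrow> P s \<subseteq> U" if U: "openin mtopology U" "x \<in> U" for U x
    proof -
      obtain r where r: "r > 0" "mball x r \<subseteq> U" using U openin_mtopology by blast
      obtain N where N: "\<And>s x y. N \<le> length s \<Longrightarrow> x \<in> P s \<Longrightarrow> y \<in> P s \<Longrightarrow> d x y < r" using small[OF r(1)] by blast
      have PM: "y \<in> P s \<Longrightarrow> y \<in> M" for s y using clop[of s] openin_subset by fastforce
      have "P s \<subseteq> mball x r" if "N \<le> length s" "x \<in> P s" for s
        using N[OF that] PM[OF that(2)] PM[of _ s] by (auto simp: in_mball)
      then show ?thesis using r(2) by blast
    qed
    fix s assume s: "\<And>i. \<exists>j. s (Suc i) = j # s i" "\<And>i. P (s i) \<noteq> {}" "s 0 = []"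
    have len: "length (s i) = i" for i
    proof (induction i)
      case (Suc i)
      then show ?case using s(1)[of i] by auto
    qed (simp add: s(3))
    have "decseq (\<lambda>i. P (s i))"
    proof (rule decseq_SucI)
      fix i
      obtain j where "s (Suc i) = j # s i" using s(1) by blast
      then show "P (s (Suc i)) \<subseteq> P (s i)" using g[of "s i"] unfolding good_def by auto
    qed
    moreover have "\<exists>n a. P (s n) \<subseteq> mcball a \<epsilon>" if eps: "\<epsilon> > 0" for \<epsilon>
    proof -
      obtain N where N: "\<And>s x y. N \<le> length s \<Longrightarrow> x \<in> P s \<Longrightarrow> y \<in> P s \<Longrightarrow> d x y < \<epsilon>" using small[OF eps] by blast
      obtain a where a: "a \<in> P (s N)" using s(2) by blast
      have PM: "y \<in> P (s N) \<Longrightarrow> y \<in> M" for y using clop[of "s N"] openin_subset by fastforce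
      have "d a y \<le> \<epsilon>" if "y \<in> P (s N)" for y using N[OF _ a that] len[of N] by simp
      then have "P (s N) \<subseteq> mcball a \<epsilon>" using PM a by (auto simp: in_mcball)
      then show ?thesis by blast
    qed
    moreover have "closedin mtopology (P (s i))" for i using clop by blast
    ultimately have "\<Inter> (range (\<lambda>i. P (s i))) \<noteq> {}"
      using s(2) by (intro mcomplete_nest[THEN iffD1, OF comp, THEN spec, THEN mp] conjI allI impI)
    then show "\<exists>x. \<forall>i. x \<in> P (s i)" by blast
  qed
  then show ?thesis by blast
qed

theorem theorem1:
  fixes G :: "'a topology"
  assumes "zero_dimensional_space G"
    and "separable_space G"
    and "completely_metrizable_space G"
  shows "\<exists>X :: point metric. suslinian X \<and> chainable X \<and>
           subtopology (mtopology_of X) (end_points X) homeomorphic_space G"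
proof -
  obtain M d where "Metric_space M d" and M: "Metric_space.mcomplete M d" "G = Metric_space.mtopology M d"
    using assms(3) unfolding completely_metrizable_space_def by blast
  then interpret Metric_space M d by blast
  obtain P where "clopen_splitting P G"
    using clopen_splitting_exists assms(1,2) M by blast
  then interpret clopen_splitting P G .
  let ?X = "metric_on limit_space"
  have "end_points ?X \<subseteq> limit_space" by (auto simp: end_points_def)
  then have "subtopology (mtopology_of ?X) (end_points ?X) = top_of_set (end_points ?X)"
    by (simp add: mtopology_of_metric_on subtopology_subtopology Int_absorb1)
  moreover have "top_of_set (end_points ?X) homeomorphic_space G"
    using thread_homeomorphic homeomorphic_map_imp_homeomorphic_space homeomorphic_space_sym by blast
  ultimately show ?thesis using suslinian_limit_space chainable_limit_space by metis
qed

end
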